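(* Let $t\geq 1$ be an integer and let $G$ be a connected graph with matching number $t$. Then \[mis(G)\leq h(t):=\begin{cases}3 & \text{if } t=1,\\ 3^{t-1}+2^{t-1} & \text{if } t\geq 2,\end{cases}\] with equality if and only if $G$ is isomorphic to a graph in $\mathcal{H}_t$, where $\mathcal{H}_1=\{K_3\}$, $\mathcal{H}_2=\{A_5,C_5,K_5\}\cup\mathcal{E}_2$, and $\mathcal{H}_t=\mathcal{E}_t$ for $t\geq 3$.
   Context: All graphs are finite and simple. $mis(G)$ is the number of maximal independent sets of $G$ (independent sets not properly contained in any other independent set). The matching number of $G$ is the maximum size of a matching of $G$. $K_n$ and $C_n$ denote the complete graph and the cycle on $n$ vertices. For an integer $t\geq 2$, $\mathcal{E}_t$ is the set of graphs obtained as follows: take $t-1$ vertex-disjoint triangles, a further vertex $c$ (the central vertex), and $\ell\geq 1$ further vertices; join $c$ to exactly one vertex of each of the $t-1$ triangles and to each of the $\ell$ further vertices (which thus are leaves adjacent to $c$); $\ell\geq1$ is arbitrary. $A_5$ is the graph on 5 vertices obtained from two disjoint copies of $K_2$ by adding a vertex adjacent to all four of their vertices (two triangles sharing one vertex). *)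

theory Defs
  imports Main "HOL-Library.Ramsey" "HOL-Library.Disjoint_Sets"
begin

text \<open>A graph is a pair of a vertex set and a set of edges, each edge being a two-element set of
  vertices. \<open>[V]\<^bsup>2\<^esup>\<close> is the set of two-element subsets of \<open>V\<close>.\<close>

type_synonym 'a graph = "'a set \<times> 'a set set"

abbreviation verts :: "'a graph \<Rightarrow> 'a set" where
  "verts \<equiv> fst"

abbreviation edges :: "'a graph \<Rightarrow> 'a set set" where
  "edges \<equiv> snd"

definition simple_graph :: "'a graph \<Rightarrow> bool" where
  "simple_graph G \<longleftrightarrow> finite (verts G) \<and> edges G \<subseteq> [verts G]\<^bsup>2\<^esup>"

definition adj :: "'a graph \<Rightarrow> ('a \<times> 'a) set" where
  "adj G = {(u, v). {u, v} \<in> edges G}"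

definition connected_graph :: "'a graph \<Rightarrow> bool" where
  "connected_graph G \<longleftrightarrow>
     verts G \<noteq> {} \<and> (\<forall>u\<in>verts G. \<forall>v\<in>verts G. (u, v) \<in> (adj G)\<^sup>*)"

definition graph_iso :: "'a graph \<Rightarrow> 'b graph \<Rightarrow> bool"  (infix \<open>\<cong>\<^sub>g\<close> 50) where
  "G \<cong>\<^sub>g H \<longleftrightarrow>
     (\<exists>f. bij_betw f (verts G) (verts H) \<and>
          (\<forall>u\<in>verts G. \<forall>v\<in>verts G. {u, v} \<in> edges G \<longleftrightarrow> {f u, f v} \<in> edges H))"

definition matching :: "'a graph \<Rightarrow> 'a set set \<Rightarrow> bool" where
  "matching G M \<longleftrightarrow> M \<subseteq> edges G \<and> disjoint M"

definition matching_number :: "'a graph \<Rightarrow> nat" where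
  "matching_number G = Max (card ` {M. matching G M})"

definition independent_set :: "'a graph \<Rightarrow> 'a set \<Rightarrow> bool" where
  "independent_set G S \<longleftrightarrow> S \<subseteq> verts G \<and> indep S (edges G)"

definition maximal_independent_set :: "'a graph \<Rightarrow> 'a set \<Rightarrow> bool" where
  "maximal_independent_set G S \<longleftrightarrow>
     independent_set G S \<and> \<not> (\<exists>T. independent_set G T \<and> S \<subset> T)"

definition mis :: "'a graph \<Rightarrow> nat" where
  "mis G = card {S. maximal_independent_set G S}"

definition complete_graph :: "nat \<Rightarrow> nat graph" where
  "complete_graph n = ({..<n}, [{..<n}]\<^bsup>2\<^esup>)"

text \<open>The following is the cycle on \<open>n\<close> vertices only for \<open>n \<ge> 3\<close>.\<close>

definition cycle_graph :: "nat \<Rightarrow> nat graph" where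
  "cycle_graph n = ({..<n}, {{i, Suc i mod n} | i. i < n})"

text \<open>Two copies of \<open>K\<^sub>2\<close>, on \<open>{1, 2}\<close> and \<open>{3, 4}\<close>, and the vertex \<open>0\<close> joined to all of them.\<close>

definition A5 :: "nat graph" where
  "A5 = ({..<5}, {{1, 2}, {3, 4}} \<union> {{0, i} | i. i \<in> {1, 2, 3, 4}})"

text \<open>The member of \<open>\<E>\<^sub>t\<close> with \<open>l\<close> leaves at the central vertex. The central vertex is \<open>0\<close>; for
  \<open>i < t - 1\<close> the \<open>i\<close>-th triangle is \<open>{3 * i + 1, 3 * i + 2, 3 * i + 3}\<close>, where \<open>3 * i + 1\<close> is the
  vertex joined to \<open>0\<close>; the leaves are the \<open>l\<close> numbers above \<open>3 * (t - 1)\<close>.\<close>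

definition E_graph :: "nat \<Rightarrow> nat \<Rightarrow> nat graph" where
  "E_graph t l =
     ({..3 * (t - 1) + l},
      (\<Union>i<t - 1. [{3 * i + 1, 3 * i + 2, 3 * i + 3}]\<^bsup>2\<^esup>)
      \<union> {{0, 3 * i + 1} | i. i < t - 1}
      \<union> {{0, v} | v. 3 * (t - 1) < v \<and> v \<le> 3 * (t - 1) + l})"

definition E_family :: "nat \<Rightarrow> nat graph set" where
  "E_family t = {E_graph t l | l. l \<ge> 1}"

text \<open>The next two definitions are meant for \<open>t \<ge> 1\<close>.\<close>

definition H_family :: "nat \<Rightarrow> nat graph set" where
  "H_family t =
     (if t = 1 then {complete_graph 3}
      else if t = 2 then {A5, cycle_graph 5, complete_graph 5} \<union> E_family 2
      else E_family t)"

definition h :: "nat \<Rightarrow> nat" where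
  "h t = (if t = 1 then 3 else 3 ^ (t - 1) + 2 ^ (t - 1))"

end

theory Submission
  imports Defs
begin

text \<open>
  If some vertex \<open>v\<close> of a connected graph \<open>G\<close> is essential, i.e. \<open>\<nu>(G - v) < \<nu>(G)\<close>, then
  \<open>mis(G) \<le> mis(G - v) + mis(G - N[v])\<close>, and the set \<open>S = N(v)\<close> meets every component of
  \<open>U = G - v\<close>, where \<open>\<nu>(U) = t - 1\<close>. Always \<open>mis(U) \<le> 3\<^sup>t\<^sup>-\<^sup>1\<close>. Moreover
  \<open>mis(U - S) \<le> 2 \<cdot> 3\<^sup>t\<^sup>-\<^sup>2\<close> for \<open>t \<ge> 2\<close>: either \<open>\<nu>(U - S) < \<nu>(U)\<close>, or every vertex of \<open>U - S\<close> with a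
  neighbour in \<open>S\<close> is essential in \<open>U - S\<close>. If all components of \<open>U\<close> have matching number at
  most 1, then the components that are not isolated vertices are stars and triangles, and
  \<open>mis(U) + mis(U - S) \<le> 3\<^sup>t\<^sup>-\<^sup>1 + 2\<^sup>t\<^sup>-\<^sup>1\<close> with equality only if all are triangles met once by
  \<open>S\<close>. A component of larger matching number makes this inequality strict, by induction on \<open>t\<close>.

  If no vertex is essential, Gallai's lemma gives \<open>|G| = 2t + 1\<close>. For \<open>t \<ge> 3\<close> the Moon--Moser
  bound \<open>mis(G)\<^sup>3 \<le> 3\<^sup>|\<^sup>G\<^sup>|\<close> is then strictly below \<open>h(t)\<^sup>3\<close>; for \<open>t = 2\<close> the graph is spanned by a
  \<open>C\<^sub>5\<close> or an \<open>A\<^sub>5\<close>, and adding some but not all of the missing edges leaves fewer than five maximal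
  independent sets.
\<close>

section \<open>Arithmetic: index blocks of length three and comparison of powers\<close>

lemma atLeastAtMost_3_Suc:
  "{1..3 * Suc k} = {1..3 * k} \<union> {3 * k + 1, 3 * k + 2, 3 * k + 3}"
  by auto

lemma mult_eq_boundsD:
  fixes a b A B :: nat
  assumes "a \<le> A" "b \<le> B" "a * b = A * B" "A > 0" "B > 0"
  shows "a = A \<and> b = B"
proof -
  have "a * b \<le> a * B" "a * B \<le> A * B" using assms(1,2) by auto
  then have "a * B = A * B" using assms(3) by linarith
  then have "a = A" using assms(5) by simp
  then show ?thesis using assms(3,4) by simp
qed

text \<open>This places the Moon-Moser bound on \<open>2 * t + 1\<close> vertices below
  \<open>h t\<close>. At \<open>t = 3\<close> it is tight:
  \<open>3 ^ 7 = 2187 < 2197 = 13 ^ 3\<close>. From \<open>t = 4\<close> on,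
  \<open>2 * t + 1 \<le> 3 * (t - 1)\<close>, so \<open>3 ^ (t - 1)\<close> alone suffices.\<close>

lemma less_if_cube_le_3_power:
  fixes m t :: nat
  assumes "m ^ 3 \<le> 3 ^ (2 * t + 1)" "3 \<le> t"
  shows "m < 3 ^ (t - 1) + 2 ^ (t - 1)"
proof (cases "t = 3")
  case True
  show ?thesis
  proof (rule ccontr)
    assume "\<not> ?thesis"
    then have "13 \<le> m" using True by simp
    then have "13 ^ 3 \<le> m ^ 3" by (rule power_mono) simp
    then show False using assms(1) True by simp
  qed
next
  case False
  have "m ^ 3 \<le> 3 ^ (2 * t + 1)" by fact
  also have "\<dots> \<le> 3 ^ ((t - 1) * 3)" using assms(2) False by (intro power_increasing) auto
  finally have "m ^ 3 \<le> (3 ^ (t - 1)) ^ 3" by (simp add: power_mult)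
  then have "m \<le> 3 ^ (t - 1)" by (simp add: power_mono_iff)
  moreover have "(2::nat) ^ (t - 1) > 0" by simp
  ultimately show ?thesis by linarith
qed

subsection \<open>The graphs in the equality case\<close>

lemma cycle_graph_5: "cycle_graph 5 = ({..<5}, {{0, 1}, {1, 2}, {2, 3}, {3, 4}, {4, 0}})"
proof -
  have "{{i, Suc i mod 5} | i. i < 5} = (\<lambda>i. {i, Suc i mod 5}) ` {..<5}" by blast
  also have "{..<5} = {0, 1, 2, 3, 4::nat}" by auto
  finally show ?thesis by (simp add: cycle_graph_def numeral_2_eq_2)
qed

lemma A5_eq: "A5 = ({..<5}, {{1, 2}, {3, 4}, {0, 1}, {0, 2}, {0, 3}, {0, 4}})"
  unfolding A5_def by auto

lemma less_5_iff: "i < 5 \<longleftrightarrow> i = 0 \<or> i = 1 \<or> i = 2 \<or> i = 3 \<or> i = (4::nat)"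
  by auto

lemma verts_E_graph [simp]: "verts (E_graph (Suc k) l) = {..3 * k + l}"
  by (simp add: E_graph_def)

text \<open>Arithmetic replaces the indexed unions: \<open>(i - 1) div 3\<close> is the index of the
  triangle containing \<open>i\<close>, and residue 1 modulo 3 marks its vertex joined to the
  centre. Triangle systems are phrased in the same terms.\<close>

lemma E_graph_edge_iff:
  fixes i j k l :: nat
  assumes "i \<le> 3 * k + l" "j \<le> 3 * k + l"
  shows "{i, j} \<in> edges (E_graph (Suc k) l) \<longleftrightarrow>
    i \<in> {1..3 * k} \<and> j \<in> {1..3 * k} \<and> i \<noteq> j \<and> (i - 1) div 3 = (j - 1) div 3 \<or>
    i = 0 \<and> (j \<in> {1..3 * k} \<and> j mod 3 = 1 \<or> 3 * k < j) \<or>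
    j = 0 \<and> (i \<in> {1..3 * k} \<and> i mod 3 = 1 \<or> 3 * k < i)" (is "_ \<longleftrightarrow> ?T \<or> ?R")
proof -
  have block: "i \<in> {3 * m + 1, 3 * m + 2, 3 * m + 3} \<longleftrightarrow> 1 \<le> i \<and> (i - 1) div 3 = m" for i m :: nat
    by auto
  have pair: "{i, j} \<in> [T]\<^bsup>2\<^esup> \<longleftrightarrow> i \<noteq> j \<and> i \<in> T \<and> j \<in> T" for T :: "nat set"
    by (auto simp: nsets_def card_insert_if)
  have le: "1 \<le> i \<and> (i - 1) div 3 < k \<longleftrightarrow> i \<in> {1..3 * k}" for i :: nat
    by auto
  have root: "(\<exists>m<k. i = 3 * m + 1) \<longleftrightarrow> i \<in> {1..3 * k} \<and> i mod 3 = 1" for i :: nat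
  proof
    assume i: "i \<in> {1..3 * k} \<and> i mod 3 = 1"
    then have "i = 3 * (i div 3) + 1" using mult_div_mod_eq[of 3 i] by simp
    moreover from this i have "i div 3 < k" by auto
    ultimately show "\<exists>m<k. i = 3 * m + 1" by blast
  qed auto
  have 1: "{i, j} \<in> (\<Union>m<k. [{3 * m + 1, 3 * m + 2, 3 * m + 3}]\<^bsup>2\<^esup>) \<longleftrightarrow> ?T"
    unfolding UN_iff Bex_def lessThan_iff pair block le[symmetric] by auto
  have 2: "{i, j} \<in> {{0, 3 * m + 1} | m. m < k} \<union> {{0, v} | v. 3 * k < v \<and> v \<le> 3 * k + l} \<longleftrightarrow> ?R"
    unfolding root[symmetric] using assms by (auto simp: doubleton_eq_iff)
  show ?thesis
    unfolding 1[symmetric] 2[symmetric] E_graph_def by (simp add: Un_assoc)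
qed

section \<open>Induced subgraphs of a fixed edge set, given by their vertex sets\<close>

locale edge_set =
  fixes E :: "'a set set"
  assumes card_edge: "e \<in> E \<Longrightarrow> card e = 2"
begin

definition adjacent :: "'a \<Rightarrow> 'a \<Rightarrow> bool" where
  "adjacent x y \<longleftrightarrow> {x, y} \<in> E"

definition nbrs :: "'a \<Rightarrow> 'a set" where
  "nbrs x = {y. adjacent x y}"

text \<open>All notions refer to the subgraph induced by \<open>W\<close>, so deleting vertices and
  passing to a component are plain set operations. Maximality of an independent set is expressed as
  domination.\<close>

definition max_indeps :: "'a set \<Rightarrow> 'a set set" where
  "max_indeps W = {S. S \<subseteq> W \<and> (\<forall>x\<in>S. \<forall>y\<in>S. \<not> adjacent x y) \<and> (\<forall>w\<in>W - S. \<exists>x\<in>S. adjacent w x)}"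

definition num_mis :: "'a set \<Rightarrow> nat" where
  "num_mis W = card (max_indeps W)"

definition matching_in :: "'a set \<Rightarrow> 'a set set \<Rightarrow> bool" where
  "matching_in W M \<longleftrightarrow> M \<subseteq> E \<and> disjoint M \<and> \<Union>M \<subseteq> W"

definition nu :: "'a set \<Rightarrow> nat" where
  "nu W = Max (card ` {M. matching_in W M})"

text \<open>Separated sets are the unions of components, so no component has to be constructed to state
  connectedness or that \<open>S\<close> meets every component.\<close>

definition separated :: "'a set \<Rightarrow> 'a set \<Rightarrow> bool" where
  "separated W C \<longleftrightarrow> C \<subseteq> W \<and> (\<forall>x\<in>C. \<forall>y\<in>W - C. \<not> adjacent x y)"

definition connected_on :: "'a set \<Rightarrow> bool" where
  "connected_on W \<longleftrightarrow> W \<noteq> {} \<and> (\<forall>C. separated W C \<and> C \<noteq> {} \<longrightarrow> C = W)"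

definition meets_all :: "'a set \<Rightarrow> 'a set \<Rightarrow> bool" where
  "meets_all S W \<longleftrightarrow> (\<forall>C. separated W C \<and> C \<noteq> {} \<longrightarrow> S \<inter> C \<noteq> {})"

text \<open>For finite \<open>W\<close>: every maximum matching of \<open>W\<close> covers
  \<open>v\<close>.\<close>

definition essential :: "'a set \<Rightarrow> 'a \<Rightarrow> bool" where
  "essential W v \<longleftrightarrow> nu (W - {v}) < nu W"

lemma adjacent_sym: "adjacent x y \<Longrightarrow> adjacent y x"
  by (simp add: adjacent_def insert_commute)

lemma adjacent_commute: "adjacent x y \<longleftrightarrow> adjacent y x"
  by (simp add: adjacent_def insert_commute)

lemma adjacent_irrefl [simp]: "\<not> adjacent x x"
  using card_edge[of "{x}"] by (auto simp: adjacent_def)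

lemma edgeE:
  assumes "e \<in> E"
  obtains x y where "e = {x, y}" "x \<noteq> y" "adjacent x y"
  using card_edge[OF assms] assms by (auto simp: card_2_iff adjacent_def)

subsection \<open>Counting maximal independent sets\<close>

lemma finite_max_indeps [simp]: "finite W \<Longrightarrow> finite (max_indeps W)"
  by (rule finite_subset[of _ "Pow W"]) (auto simp: max_indeps_def)

lemma max_indeps_remove:
  assumes "S \<in> max_indeps W" "v \<in> S"
  shows "S - {v} \<in> max_indeps (W - {v} - nbrs v)"
proof -
  have S: "S \<subseteq> W" "\<And>x y. x \<in> S \<Longrightarrow> y \<in> S \<Longrightarrow> \<not> adjacent x y"
    "\<And>w. w \<in> W \<Longrightarrow> w \<notin> S \<Longrightarrow> \<exists>x\<in>S. adjacent w x"
    using assms(1) by (auto simp: max_indeps_def)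
  have "\<exists>x\<in>S - {v}. adjacent w x" if w: "w \<in> W - {v} - nbrs v - (S - {v})" for w
  proof -
    obtain x where "x \<in> S" "adjacent w x" using S(3) w by blast
    moreover from this have "x \<noteq> v" using w adjacent_sym by (auto simp: nbrs_def)
    ultimately show ?thesis by blast
  qed
  then show ?thesis
    using S(1,2) assms(2) by (auto simp: max_indeps_def nbrs_def)
qed

text \<open>A maximal independent set that omits \<open>v\<close> must dominate it, hence meets
  \<open>nbrs v\<close>; one that contains \<open>v\<close> is determined by its trace outside the
  closed neighbourhood of \<open>v\<close>.\<close>

lemma max_indeps_split:
  assumes "v \<in> W"
  shows "max_indeps W = {S \<in> max_indeps (W - {v}). S \<inter> nbrs v \<noteq> {}}
           \<union> insert v ` max_indeps (W - {v} - nbrs v)" (is "?L = ?A \<union> ?B")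
proof (intro equalityI subsetI)
  fix S assume S: "S \<in> ?L"
  show "S \<in> ?A \<union> ?B"
  proof (cases "v \<in> S")
    case True
    then have "S - {v} \<in> max_indeps (W - {v} - nbrs v)"
      using S by (rule max_indeps_remove[rotated])
    moreover have "S = insert v (S - {v})" using True by auto
    ultimately show ?thesis by blast
  next
    case False
    then have "S \<in> ?A" using S assms unfolding max_indeps_def nbrs_def by auto
    then show ?thesis by blast
  qed
next
  fix S assume "S \<in> ?A \<union> ?B"
  then show "S \<in> ?L"
    using assms unfolding max_indeps_def nbrs_def by (auto simp: adjacent_commute)
qed

lemma num_mis_split:
  assumes "finite W" "v \<in> W"
  shows "num_mis W = card {S \<in> max_indeps (W - {v}). S \<inter> nbrs v \<noteq> {}}
           + num_mis (W - {v} - nbrs v)"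
proof -
  have "inj_on (insert v) (max_indeps (W - {v} - nbrs v))"
    by (rule inj_onI) (auto simp: max_indeps_def)
  moreover have "{S \<in> max_indeps (W - {v}). S \<inter> nbrs v \<noteq> {}}
      \<inter> insert v ` max_indeps (W - {v} - nbrs v) = {}"
    by (auto simp: max_indeps_def)
  ultimately show ?thesis
    unfolding num_mis_def max_indeps_split[OF assms(2)] using assms(1)
    by (subst card_Un_disjoint) (auto simp: card_image)
qed

lemma num_mis_le_add:
  assumes "finite W" "v \<in> W"
  shows "num_mis W \<le> num_mis (W - {v}) + num_mis (W - {v} - nbrs v)"
  unfolding num_mis_split[OF assms] using assms
  by (auto simp: num_mis_def intro!: card_mono)

text \<open>The witness \<open>S\<close> is maximal in \<open>W - {v}\<close> but can be enlarged by
  \<open>v\<close>, so the first summand overcounts. This is what excludes equality when the centre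
  has no leaf.\<close>

lemma num_mis_less_add:
  assumes "finite W" "v \<in> W" "S \<in> max_indeps (W - {v})" "S \<inter> nbrs v = {}"
  shows "num_mis W < num_mis (W - {v}) + num_mis (W - {v} - nbrs v)"
  unfolding num_mis_split[OF assms(1,2)] using assms
  by (auto simp: num_mis_def intro!: psubset_card_mono)

text \<open>By domination every maximal independent set contains some vertex of the closed
  neighbourhood of \<open>v\<close>; branching on that vertex is the step behind the Moon-Moser
  bound.\<close>

lemma num_mis_le_sum:
  assumes "finite W" "v \<in> W"
  shows "num_mis W \<le> (\<Sum>u\<in>insert v (nbrs v) \<inter> W. num_mis (W - {u} - nbrs u))"
proof -
  let ?U = "insert v (nbrs v) \<inter> W"
  have "max_indeps W \<subseteq> (\<Union>u\<in>?U. insert u ` max_indeps (W - {u} - nbrs u))"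
  proof
    fix S assume S: "S \<in> max_indeps W"
    have "\<exists>u\<in>?U. u \<in> S"
    proof (cases "v \<in> S")
      case False
      then obtain u where "u \<in> S" "adjacent v u" using S assms(2) unfolding max_indeps_def by blast
      then show ?thesis using S by (auto simp: max_indeps_def nbrs_def)
    qed (use assms(2) in auto)
    then obtain u where u: "u \<in> ?U" "u \<in> S" by blast
    then have "S - {u} \<in> max_indeps (W - {u} - nbrs u)"
      using S by (intro max_indeps_remove)
    moreover have "S = insert u (S - {u})" using u by auto
    ultimately show "S \<in> (\<Union>u\<in>?U. insert u ` max_indeps (W - {u} - nbrs u))"
      using u(1) by blast
  qed
  then have "num_mis W \<le> card (\<Union>u\<in>?U. insert u ` max_indeps (W - {u} - nbrs u))"
    unfolding num_mis_def using assms(1) by (intro card_mono) auto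
  also have "\<dots> \<le> (\<Sum>u\<in>?U. card (insert u ` max_indeps (W - {u} - nbrs u)))"
    using assms(1) by (intro card_UN_le) auto
  also have "\<dots> \<le> (\<Sum>u\<in>?U. num_mis (W - {u} - nbrs u))"
    unfolding num_mis_def using assms(1) by (intro sum_mono card_image_le) auto
  finally show ?thesis .
qed

lemma num_mis_empty [simp]: "num_mis {} = 1"
proof -
  have "max_indeps {} = {{}}" by (auto simp: max_indeps_def)
  then show ?thesis by (simp add: num_mis_def)
qed

lemma separated_Diff: "separated W C \<Longrightarrow> separated W (W - C)"
  unfolding separated_def by (blast intro: adjacent_sym)

lemma separated_trans: "separated W C \<Longrightarrow> separated C D \<Longrightarrow> separated W D"
  unfolding separated_def by blast

lemma separated_Diff_set: "separated W C \<Longrightarrow> separated (W - S) (C - S)"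
  unfolding separated_def by blast

text \<open>No edges run between \<open>C\<close> and \<open>W - C\<close>, so a maximal independent
  set is a free choice of one on each side.\<close>

lemma num_mis_separated:
  assumes "separated W C"
  shows "num_mis W = num_mis C * num_mis (W - C)"
proof -
  have "bij_betw (\<lambda>(S, T). S \<union> T) (max_indeps C \<times> max_indeps (W - C)) (max_indeps W)"
  proof (rule bij_betw_byWitness[where f' = "\<lambda>S. (S \<inter> C, S - C)"])
    show "\<forall>p\<in>max_indeps C \<times> max_indeps (W - C).
        (\<lambda>S. (S \<inter> C, S - C)) (case p of (S, T) \<Rightarrow> S \<union> T) = p"
      by (auto simp: max_indeps_def)
    show "\<forall>S\<in>max_indeps W. (case (S \<inter> C, S - C) of (S, T) \<Rightarrow> S \<union> T) = S"
      by auto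
    show "(\<lambda>(S, T). S \<union> T) ` (max_indeps C \<times> max_indeps (W - C)) \<subseteq> max_indeps W"
      using assms separated_Diff[OF assms] unfolding max_indeps_def separated_def
      by auto blast+
    show "(\<lambda>S. (S \<inter> C, S - C)) ` max_indeps W \<subseteq> max_indeps C \<times> max_indeps (W - C)"
      using assms separated_Diff[OF assms] unfolding max_indeps_def separated_def
      by auto blast+
  qed
  then show ?thesis
    unfolding num_mis_def by (metis bij_betw_same_card card_cartesian_product)
qed

subsection \<open>Matching numbers of vertex sets\<close>

lemma finite_matchings: "finite W \<Longrightarrow> finite {M. matching_in W M}"
  by (rule finite_subset[of _ "Pow (Pow W)"]) (auto simp: matching_in_def)

lemma matching_in_empty [simp]: "matching_in W {}"
  by (simp add: matching_in_def disjoint_def)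

lemma card_le_nu: "finite W \<Longrightarrow> matching_in W M \<Longrightarrow> card M \<le> nu W"
  unfolding nu_def by (rule Max_ge) (auto simp: finite_matchings)

lemma nu_witness:
  assumes "finite W"
  obtains M where "matching_in W M" "card M = nu W"
proof -
  have "nu W \<in> card ` {M. matching_in W M}"
    unfolding nu_def using assms finite_matchings
    by (intro Max_in) (auto intro: matching_in_empty)
  then show ?thesis using that by auto
qed

lemma matching_in_mono: "matching_in W M \<Longrightarrow> W \<subseteq> W' \<Longrightarrow> matching_in W' M"
  by (auto simp: matching_in_def)

lemma nu_mono: "finite W' \<Longrightarrow> W \<subseteq> W' \<Longrightarrow> nu W \<le> nu W'"
  by (metis card_le_nu finite_subset matching_in_mono nu_witness)

lemma finite_matching: "finite W \<Longrightarrow> matching_in W M \<Longrightarrow> finite M"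
  by (meson finite_UnionD finite_subset matching_in_def)

lemma matching_in_insert:
  assumes "matching_in W M" "adjacent x y" "x \<notin> \<Union>M" "y \<notin> \<Union>M" "x \<in> W'" "y \<in> W'" "W \<subseteq> W'"
  shows "matching_in W' (insert {x, y} M)"
  using assms unfolding matching_in_def adjacent_def disjoint_def by auto

lemma card_insert_matching:
  assumes "finite W" "matching_in W M" "x \<notin> \<Union>M"
  shows "card (insert {x, y} M) = Suc (card M)"
  using assms finite_matching by (subst card_insert_disjoint) auto

lemma nu_edge:
  assumes "finite W" "adjacent x y" "x \<in> W" "y \<in> W" "W' \<subseteq> W - {x, y}"
  shows "Suc (nu W') \<le> nu W"
proof -
  have fin: "finite W'" using assms(1,5) by (meson Diff_subset finite_subset)
  obtain M where M: "matching_in W' M" "card M = nu W'" using nu_witness[OF fin] .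
  have xy: "x \<notin> \<Union>M" "y \<notin> \<Union>M" using M assms(5) by (auto simp: matching_in_def)
  have "matching_in W (insert {x, y} M)"
    using matching_in_insert[OF M(1) assms(2) xy assms(3,4)] assms(5) by blast
  then show ?thesis
    using card_le_nu[OF assms(1)] card_insert_matching[OF fin M(1) xy(1)] M(2) by metis
qed

lemma nu_remove_vertex:
  assumes "finite W"
  shows "nu W \<le> Suc (nu (W - {v}))"
proof -
  obtain M where M: "matching_in W M" "card M = nu W" using nu_witness[OF assms] .
  have fM: "finite M" using finite_matching[OF assms M(1)] .
  have mat: "matching_in (W - {v}) {e \<in> M. v \<notin> e}"
    using M(1) unfolding matching_in_def by (auto simp: disjoint_def)
  have "card {e \<in> M. v \<in> e} \<le> 1"
    using M(1) fM unfolding matching_in_def disjoint_def by (auto simp: card_le_Suc0_iff_eq)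
  moreover have "card M = card {e \<in> M. v \<in> e} + card {e \<in> M. v \<notin> e}"
    using fM by (subst card_Un_disjoint[symmetric]) (auto intro: arg_cong[of _ _ card])
  ultimately show ?thesis
    using card_le_nu[OF _ mat] assms M(2) by auto
qed

lemma nu_separated:
  assumes "finite W" "separated W C"
  shows "nu W = nu C + nu (W - C)"
proof (rule antisym)
  have C: "C \<subseteq> W" "finite C" using assms finite_subset by (auto simp: separated_def)
  obtain M where M: "matching_in W M" "card M = nu W" using nu_witness[OF assms(1)] .
  have fM: "finite M" using finite_matching[OF assms(1) M(1)] .
  have "e \<subseteq> C \<or> e \<subseteq> W - C" if "e \<in> M" for e
  proof -
    have "e \<in> E" "e \<subseteq> W" using that M(1) by (auto simp: matching_in_def)
    then show ?thesis
      using assms(2) separated_Diff[OF assms(2)] by (auto simp: separated_def elim!: edgeE)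
  qed
  then have "M = {e \<in> M. e \<subseteq> C} \<union> {e \<in> M. e \<subseteq> W - C}" by auto
  then have "card M \<le> card {e \<in> M. e \<subseteq> C} + card {e \<in> M. e \<subseteq> W - C}"
    by (metis card_Un_le)
  also have "\<dots> \<le> nu C + nu (W - C)"
    using M(1) C(2) assms(1)
    by (intro add_mono card_le_nu) (auto simp: matching_in_def disjoint_def)
  finally show "nu W \<le> nu C + nu (W - C)" using M(2) by simp
next
  have C: "C \<subseteq> W" "finite C" "finite (W - C)"
    using assms finite_subset by (auto simp: separated_def)
  obtain M where M: "matching_in C M" "card M = nu C" using nu_witness[OF C(2)] .
  obtain M' where M': "matching_in (W - C) M'" "card M' = nu (W - C)" using nu_witness[OF C(3)] .
  have "matching_in W (M \<union> M')"
    using M(1) M'(1) C(1) unfolding matching_in_def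
    by (intro conjI disjoint_union) blast+
  moreover have "M \<inter> M' = {}"
  proof (rule ccontr)
    assume "M \<inter> M' \<noteq> {}"
    then obtain e where "e \<in> M" "e \<in> M'" by blast
    moreover from this have "e \<noteq> {}" using M(1) edgeE by (force simp: matching_in_def)
    ultimately show False using M(1) M'(1) unfolding matching_in_def by blast
  qed
  ultimately show "nu C + nu (W - C) \<le> nu W"
    using card_le_nu[OF assms(1)] M M' finite_matching C by (metis card_Un_disjoint)
qed

text \<open>Branch at the ends of an edge \<open>{x, y}\<close>: first on \<open>x\<close>, then, if
  \<open>x\<close> is omitted, on \<open>y\<close>. Each of the three remaining vertex sets avoids
  both \<open>x\<close> and \<open>y\<close>, so its matching number is smaller, and the induction
  hypothesis bounds each branch by a third of the claim.\<close>

lemma num_mis_le_power_nu: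
  assumes "finite W"
  shows "num_mis W \<le> 3 ^ nu W"
  using assms
proof (induction "nu W" arbitrary: W rule: less_induct)
  case less
  show ?case
  proof (cases "\<exists>x\<in>W. \<exists>y\<in>W. adjacent x y")
    case False
    then have "max_indeps W = {W}" unfolding max_indeps_def by blast
    then show ?thesis by (simp add: num_mis_def)
  next
    case True
    then obtain x y where xy: "x \<in> W" "y \<in> W" "adjacent x y" by blast
    then have ne: "x \<noteq> y" by auto
    have "num_mis W \<le> num_mis (W - {x}) + num_mis (W - {x} - nbrs x)"
      using num_mis_le_add less.prems xy(1) by blast
    moreover have "num_mis (W - {x}) \<le> num_mis (W - {x} - {y}) + num_mis (W - {x} - {y} - nbrs y)"
      using num_mis_le_add[of "W - {x}" y] less.prems xy ne by simp
    moreover have bound: "num_mis V \<le> 3 ^ (nu W - 1)" if "V \<subseteq> W - {x, y}" for V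
    proof -
      have fin: "finite V" using that less.prems by (meson Diff_subset finite_subset)
      have "Suc (nu V) \<le> nu W" using nu_edge[OF less.prems xy(3,1,2) that] .
      then have "num_mis V \<le> 3 ^ nu V" "(3::nat) ^ nu V \<le> 3 ^ (nu W - 1)"
        using less.hyps[OF _ fin] by (auto intro!: power_increasing)
      then show ?thesis by linarith
    qed
    have "num_mis (W - {x} - nbrs x) \<le> 3 ^ (nu W - 1)"
      by (rule bound) (use xy in \<open>auto simp: nbrs_def\<close>)
    moreover have "num_mis (W - {x} - {y}) \<le> 3 ^ (nu W - 1)"
      by (rule bound) auto
    moreover have "num_mis (W - {x} - {y} - nbrs y) \<le> 3 ^ (nu W - 1)"
      by (rule bound) auto
    \<comment> \<open>The edge itself gives \<open>nu W \<ge> 1\<close>, so the truncated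
      subtraction is a true one.\<close>
    moreover have "3 * 3 ^ (nu W - 1) = (3::nat) ^ nu W"
      using nu_edge[OF less.prems xy(3,1,2), of "{}"] by (cases "nu W") auto
    ultimately show ?thesis by linarith
  qed
qed

lemma num_mis_essential:
  assumes "finite W" "v \<in> W" "essential W v" "W' \<subseteq> W - {v}"
  shows "num_mis W' \<le> 3 ^ (nu W - 1)"
proof -
  have "finite W'" using assms(1,4) by (meson Diff_subset finite_subset)
  then have "num_mis W' \<le> 3 ^ nu W'" by (rule num_mis_le_power_nu)
  also have "\<dots> \<le> 3 ^ (nu W - 1)"
    using assms nu_mono[of "W - {v}" W'] by (intro power_increasing) (auto simp: essential_def)
  finally show ?thesis .
qed

text \<open>Both branches at \<open>v\<close> live inside \<open>W - {v}\<close>, whose matching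
  number is smaller.\<close>

lemma num_mis_essential_le:
  assumes "finite W" "v \<in> W" "essential W v"
  shows "num_mis W \<le> 2 * 3 ^ (nu W - 1)"
  using num_mis_le_add[OF assms(1,2)] num_mis_essential[OF assms, of "W - {v}"]
    num_mis_essential[OF assms, of "W - {v} - nbrs v"] by auto

subsection \<open>Factor-critical graphs\<close>

lemma connected_crossing:
  assumes "connected_on W" "X \<subseteq> W" "X \<noteq> {}" "X \<noteq> W"
  obtains x y where "x \<in> X" "y \<in> W - X" "adjacent x y"
  using assms unfolding connected_on_def separated_def by blast

lemma edge_atE:
  assumes "e \<in> E" "x \<in> e"
  obtains y where "e = {x, y}" "x \<noteq> y" "adjacent x y"
proof -
  obtain a b where ab: "e = {a, b}" "a \<noteq> b" "adjacent a b" using edgeE[OF assms(1)] .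
  show ?thesis
  proof (cases "x = a")
    case True
    then show ?thesis using ab that by blast
  next
    case False
    then show ?thesis using ab assms(2) that[of a] adjacent_sym by blast
  qed
qed

lemma card_Union_matching:
  assumes "finite W" "matching_in W M"
  shows "card (\<Union>M) = 2 * card M"
proof -
  have "card (\<Union>M) = (\<Sum>e\<in>M. card e)"
    using assms by (intro card_Union_disjoint)
      (auto simp: matching_in_def intro: finite_subset[OF _ assms(1)])
  also have "\<dots> = (\<Sum>e\<in>M. 2)"
    using assms by (intro sum.cong) (auto simp: matching_in_def intro: card_edge)
  finally show ?thesis by simp
qed

lemma nonessential_witness:
  assumes "finite W" "\<not> essential W v"
  obtains M where "matching_in W M" "card M = nu W" "v \<notin> \<Union>M"
proof -
  have fin: "finite (W - {v})" using assms by simp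
  have "nu (W - {v}) = nu W"
    using assms nu_mono[OF assms(1), of "W - {v}"] by (auto simp: essential_def)
  then obtain M where "matching_in (W - {v}) M" "card M = nu W"
    using nu_witness[OF fin] by metis
  moreover from this have "matching_in W M" "v \<notin> \<Union>M"
    by (auto simp: matching_in_def)
  ultimately show ?thesis using that by blast
qed

text \<open>The swapping step of Gallai's lemma: moving \<open>N\<close> towards \<open>M\<close> one edge at a time keeps
  \<open>v\<close> missed by \<open>N\<close>.\<close>

lemma no_missed_swap:
  assumes fin: "finite W" and M: "matching_in W M" "card M = nu W" "u \<notin> \<Union>M" "w \<notin> \<Union>M"
    and ne: "u \<noteq> w" and N: "matching_in W N" "card N = nu W" "v \<notin> \<Union>N"
    and max: "\<And>K. matching_in W K \<Longrightarrow> card K = nu W \<Longrightarrow> v \<notin> \<Union>K \<Longrightarrow> u \<in> \<Union>K \<and> w \<in> \<Union>K"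
  shows False
  using N
proof (induction "card (M - N)" arbitrary: N rule: less_induct)
  case less
  note N = less.prems
  have fM: "finite M" and fN: "finite N" using finite_matching fin M(1) N(1) by auto
  have fU: "finite (\<Union>M)" "finite (\<Union>N)"
    using M(1) N(1) fin finite_subset by (auto simp: matching_in_def)
  \<comment> \<open>Both matchings cover equally many vertices, and \<open>N\<close> covers
    \<open>u\<close> and \<open>w\<close>, which \<open>M\<close> misses. So \<open>M\<close> covers
    at least two vertices missed by \<open>N\<close>, and one of them differs from
    \<open>v\<close>.\<close>
  have "card (\<Union>M) = card (\<Union>N)"
    using card_Union_matching[OF fin M(1)] card_Union_matching[OF fin N(1)] M(2) N(2) by simp
  then have "card (\<Union>N - \<Union>M) \<le> card (\<Union>M - \<Union>N)"
    using card_le_sym_Diff[OF fU(2,1)] by simp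
  moreover have "card {u, w} \<le> card (\<Union>N - \<Union>M)"
  proof (rule card_mono)
    show "{u, w} \<subseteq> \<Union>N - \<Union>M" using max[OF N] M(3,4) by blast
  qed (use fU in blast)
  moreover have "card {u, w} = 2" using ne by simp
  ultimately have two: "2 \<le> card (\<Union>M - \<Union>N)" by linarith
  have "\<not> \<Union>M - \<Union>N \<subseteq> {v}"
  proof
    assume "\<Union>M - \<Union>N \<subseteq> {v}"
    from card_mono[OF _ this] two show False by simp
  qed
  then obtain x where x: "x \<in> \<Union>M" "x \<notin> \<Union>N" "x \<noteq> v" by blast
  then obtain f where f: "f \<in> M" "x \<in> f" by blast
  then have fE: "f \<in> E" using M(1) by (auto simp: matching_in_def)
  obtain y where y: "f = {x, y}" "x \<noteq> y" "adjacent x y"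
    using edge_atE[OF fE f(2)] .
  have xyW: "x \<in> W" "y \<in> W" using f y M(1) by (auto simp: matching_in_def)
  have yN: "y \<in> \<Union>N"
  proof (rule ccontr)
    assume "y \<notin> \<Union>N"
    then have "matching_in W (insert {x, y} N)"
      using matching_in_insert[OF N(1) y(3) x(2)] xyW by blast
    then show False
      using card_le_nu[OF fin] card_insert_matching[OF fin N(1) x(2)] N(2) by fastforce
  qed
  then obtain e where e: "e \<in> N" "y \<in> e" by blast
  \<comment> \<open>The exchange keeps the size and still misses \<open>v\<close>, because
    \<open>x\<close> is not \<open>v\<close> and \<open>y\<close> was already covered by
    \<open>N\<close>. It gains the edge \<open>f\<close> of \<open>M\<close> and loses
    \<open>e\<close>, which is not in \<open>M\<close> since it meets \<open>f\<close> in
    \<open>y\<close>; so \<open>M - N\<close> shrinks.\<close>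
  let ?N = "insert f (N - {e})"
  have eM: "e \<notin> M"
  proof
    assume "e \<in> M"
    moreover have "e \<noteq> f" "e \<inter> f \<noteq> {}" using f(2) e x(2) y(1) by auto
    ultimately show False using M(1) f(1) unfolding matching_in_def disjoint_def by blast
  qed
  have fnN: "f \<notin> N" using x(2) f(2) by blast
  have "y \<notin> \<Union>(N - {e})"
    using N(1) e by (auto simp: matching_in_def disjoint_def)
  moreover have "matching_in W (N - {e})"
    using N(1) by (auto simp: matching_in_def disjoint_def)
  ultimately have N': "matching_in W ?N"
    using matching_in_insert[of W "N - {e}" x y W] y x(2) xyW by auto
  have "card ?N = card N"
    using fN fnN card_Suc_Diff1[OF fN e(1)] by simp
  moreover have "v \<notin> \<Union>?N" using N(3) x(3) y(1) yN by auto
  moreover have "card (M - ?N) < card (M - N)"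
    using fM f(1) fnN eM by (intro psubset_card_mono) auto
  ultimately show False using less.hyps[OF _ N'] N(2) by simp
qed

text \<open>Let \<open>indist u v\<close> mean that no maximum matching misses both \<open>u\<close>
  and \<open>v\<close> unless they coincide. Adjacent vertices satisfy it, as their edge could
  otherwise be added, and the swapping argument makes it transitive. Connectedness then spreads it
  over \<open>W\<close>, so a maximum matching missing \<open>u\<close> misses nothing else.\<close>

lemma gallai:
  assumes fin: "finite W" and con: "connected_on W" and ness: "\<And>v. v \<in> W \<Longrightarrow> \<not> essential W v"
  shows "card W = 2 * nu W + 1"
proof -
  define indist where "indist u v \<longleftrightarrow>
    (\<forall>K. matching_in W K \<longrightarrow> card K = nu W \<longrightarrow> v \<notin> \<Union>K \<longrightarrow> u = v \<or> u \<in> \<Union>K)" for u v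
  have sym: "indist v u" if "indist u v" for u v using that unfolding indist_def by blast
  have trans: "indist u w" if uv: "indist u v" and vw: "indist v w" and "v \<in> W" for u v w
  proof (rule ccontr)
    assume c: "\<not> indist u w"
    then obtain M where M: "matching_in W M" "card M = nu W" "u \<notin> \<Union>M" "w \<notin> \<Union>M" "u \<noteq> w"
      unfolding indist_def by blast
    obtain N where N: "matching_in W N" "card N = nu W" "v \<notin> \<Union>N"
      using nonessential_witness[OF fin ness[OF \<open>v \<in> W\<close>]] by blast
    have "u \<noteq> v" "w \<noteq> v" using c uv vw by auto
    then have "u \<in> \<Union>K \<and> w \<in> \<Union>K"
      if "matching_in W K" "card K = nu W" "v \<notin> \<Union>K" for K
      using that uv sym[OF vw] unfolding indist_def by blast
    then show False by (rule no_missed_swap[OF fin M N])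
  qed
  have adj: "indist u v" if "adjacent u v" "u \<in> W" "v \<in> W" for u v
    unfolding indist_def
  proof (intro allI impI, rule ccontr)
    fix K assume K: "matching_in W K" "card K = nu W" "v \<notin> \<Union>K" "\<not> (u = v \<or> u \<in> \<Union>K)"
    then have "matching_in W (insert {u, v} K)"
      using matching_in_insert[OF K(1) that(1)] that by blast
    then show False
      using card_le_nu[OF fin] card_insert_matching[OF fin K(1), of u v] K by fastforce
  qed
  obtain u where u: "u \<in> W" using con by (auto simp: connected_on_def)
  have all: "{v \<in> W. indist u v} = W"
  proof (rule ccontr)
    assume "{v \<in> W. indist u v} \<noteq> W"
    moreover have "u \<in> {v \<in> W. indist u v}" using u by (simp add: indist_def)
    ultimately obtain x y where xy: "x \<in> W" "indist u x" "y \<in> W" "\<not> indist u y" "adjacent x y"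
      using connected_crossing[OF con, of "{v \<in> W. indist u v}"] by blast
    show False using xy(4) trans[OF xy(2) adj[OF xy(5,1,3)] xy(1)] by contradiction
  qed
  obtain M where M: "matching_in W M" "card M = nu W" "u \<notin> \<Union>M"
    using nonessential_witness[OF fin ness[OF u]] by blast
  have "v \<in> \<Union>M" if "v \<in> W" "v \<noteq> u" for v
    using all that sym[of u v] M unfolding indist_def by blast
  then have "W = insert u (\<Union>M)" using u M(1) by (auto simp: matching_in_def)
  moreover have "finite (\<Union>M)" using M(1) fin finite_subset by (auto simp: matching_in_def)
  ultimately show ?thesis
    using card_Union_matching[OF fin M(1)] M(2,3) by simp
qed

text \<open>The bound \<open>3 ^ (n / 3)\<close> is cubed to stay in the natural numbers. Branch
  over the closed neighbourhood of a vertex \<open>v\<close> of minimum degree, of size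
  \<open>c\<close>: there are \<open>c\<close> branches, each deleting at least \<open>c\<close>
  vertices by minimality, and \<open>c ^ 3 \<le> 3 ^ c\<close> closes the induction.\<close>

lemma moon_moser:
  assumes "finite W"
  shows "num_mis W ^ 3 \<le> 3 ^ card W"
  using assms
proof (induction "card W" arbitrary: W rule: less_induct)
  case less
  show ?case
  proof (cases "W = {}")
    case True
    then show ?thesis by simp
  next
    case False
    let ?c = "\<lambda>u. card (insert u (nbrs u) \<inter> W)"
    define v where "v = arg_min_on ?c W"
    have v: "v \<in> W" "\<And>u. u \<in> W \<Longrightarrow> ?c v \<le> ?c u"
      using arg_min_if_finite[OF less.prems False, of ?c] unfolding v_def by (auto simp: not_less)
    let ?U = "insert v (nbrs v) \<inter> W"
    have Ufin: "finite ?U" "?U \<noteq> {}" using v(1) less.prems by auto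
    have le: "?c v \<le> card W" using less.prems by (intro card_mono) auto
    have pos: "?c v > 0" using Ufin by (simp add: card_gt_0_iff)
    have bound: "num_mis (W - {u} - nbrs u) ^ 3 \<le> 3 ^ (card W - ?c v)" if "u \<in> ?U" for u
    proof -
      have eq: "card (W - {u} - nbrs u) = card W - ?c u"
        using less.prems
        by (subst card_Diff_subset[symmetric]) (auto intro!: arg_cong[of _ _ card])
      have cv: "?c v \<le> ?c u" using v(2) that by auto
      then have "card (W - {u} - nbrs u) < card W" using eq pos le by linarith
      then have "num_mis (W - {u} - nbrs u) ^ 3 \<le> 3 ^ card (W - {u} - nbrs u)"
        using less.hyps less.prems by simp
      also have "\<dots> \<le> 3 ^ (card W - ?c v)"
        using eq cv by (intro power_increasing) auto
      finally show ?thesis .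
    qed
    let ?m = "\<lambda>u. num_mis (W - {u} - nbrs u)"
    \<comment> \<open>The branch with the largest count bounds all summands, so the sum becomes a
      product that can be cubed.\<close>
    have "Max (?m ` ?U) \<in> ?m ` ?U" using Ufin by (intro Max_in) auto
    then obtain u where "u \<in> ?U" "?m u = Max (?m ` ?U)" by (metis (no_types, lifting) imageE)
    moreover have "?m u' \<le> Max (?m ` ?U)" if "u' \<in> ?U" for u'
      using Ufin(1) that by (intro Max_ge) auto
    ultimately have u: "u \<in> ?U" "\<And>u'. u' \<in> ?U \<Longrightarrow> ?m u' \<le> ?m u" by auto
    have "num_mis W \<le> ?c v * num_mis (W - {u} - nbrs u)"
      using order_trans[OF num_mis_le_sum[OF less.prems v(1)] sum_bounded_above[OF u(2)]] by simp
    then have "num_mis W ^ 3 \<le> (?c v * num_mis (W - {u} - nbrs u)) ^ 3"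
      by (rule power_mono) simp
    also have "\<dots> = ?c v ^ 3 * num_mis (W - {u} - nbrs u) ^ 3" by (simp add: power_mult_distrib)
    also have "\<dots> \<le> 3 ^ ?c v * 3 ^ (card W - ?c v)"
    proof (rule mult_mono[OF _ bound[OF u(1)]])
      \<comment> \<open>Equality holds at \<open>n = 3\<close>; beyond, passing to
        \<open>Suc n\<close> multiplies the cube by at most 3.\<close>
      have "(n::nat) ^ 3 \<le> 3 ^ n" for n
      proof (cases "n < 3")
        case True
        then have "n = 0 \<or> n = 1 \<or> n = 2" by auto
        then show ?thesis by auto
      next
        case False
        then have "3 \<le> n" by simp
        then show ?thesis
        proof (induction n rule: dec_induct)
          case (step n)
          have "3 * n \<le> n * n" "3 * (n * n) \<le> n * (n * n)" using step.hyps by auto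
          moreover have "Suc n ^ 3 = n * (n * n) + 3 * (n * n) + 3 * n + 1"
            by (simp add: power3_eq_cube algebra_simps)
          moreover have "n ^ 3 = n * (n * n)" by (simp add: power3_eq_cube)
          ultimately have "Suc n ^ 3 \<le> 3 * n ^ 3" using step.hyps by linarith
          then show ?case using step.IH by simp
        qed simp
      qed
      then show "?c v ^ 3 \<le> 3 ^ ?c v" .
    qed simp_all
    also have "\<dots> = 3 ^ card W" using le by (simp flip: power_add)
    finally show ?thesis .
  qed
qed

subsection \<open>Components of small matching number\<close>

text \<open>A nonempty separated set of least size is connected, because a set separated in it is
  also separated in \<open>W\<close>.\<close>

lemma component_exists:
  assumes "finite W" "W \<noteq> {}"
  obtains C where "separated W C" "connected_on C"
proof -
  let ?P = "\<lambda>C. separated W C \<and> C \<noteq> {}"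
  have "?P W" using assms by (simp add: separated_def)
  then obtain C where C: "?P C" "\<And>D. ?P D \<Longrightarrow> card C \<le> card D"
    using ex_has_least_nat[of ?P W card] by blast
  have "finite C" using C(1) assms(1) finite_subset by (auto simp: separated_def)
  then have "D = C" if "separated C D" "D \<noteq> {}" for D
    using that C separated_trans[of W C D] card_seteq[of C D] unfolding separated_def by blast
  then show ?thesis using that C(1) by (auto simp: connected_on_def)
qed

lemma meets_all_separated: "meets_all S W \<Longrightarrow> separated W C \<Longrightarrow> meets_all S C"
  unfolding meets_all_def using separated_trans by blast

lemma nu_empty: "nu {} = 0"
proof -
  obtain M where M: "matching_in {} M" "card M = nu {}" using nu_witness[of "{}"] by blast
  have "2 * card M = card (\<Union>M)" using card_Union_matching[OF _ M(1)] by simp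
  moreover have "\<Union>M = {}" using M(1) by (simp add: matching_in_def)
  ultimately show ?thesis using M(2) by simp
qed

text \<open>Suppose deleting \<open>S\<close> does not lower the matching number. Since
  \<open>S\<close> meets every nonempty separated set, \<open>W - S\<close> is not separated, so
  some \<open>x\<close> in it has a neighbour \<open>u\<close> in \<open>S\<close>. A matching of
  \<open>W - S\<close> missing \<open>x\<close> extends by \<open>{x, u}\<close>, so
  \<open>x\<close> is essential in \<open>W - S\<close> and branching at \<open>x\<close> gives the
  factor 2.\<close>

lemma num_mis_Diff_le:
  assumes "finite W" "meets_all S W" "nu W \<ge> 1"
  shows "num_mis (W - S) \<le> 2 * 3 ^ (nu W - 1)"
proof (cases "nu (W - S) < nu W")
  case True
  have "num_mis (W - S) \<le> 3 ^ nu (W - S)" using assms(1) by (intro num_mis_le_power_nu) simp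
  also have "\<dots> \<le> 3 ^ (nu W - 1)" using True by (intro power_increasing) auto
  finally show ?thesis by simp
next
  case False
  let ?D = "W - S"
  have D: "finite ?D" "nu ?D = nu W"
    using False assms(1) nu_mono[of W ?D] by auto
  have "?D \<noteq> {}"
  proof
    assume "?D = {}"
    then have "nu ?D = 0" by (simp only: nu_empty)
    then show False using D(2) assms(3) by simp
  qed
  then have "\<not> separated W ?D" using assms(2) unfolding meets_all_def by blast
  then obtain x u where xu: "x \<in> ?D" "u \<in> W" "u \<notin> ?D" "adjacent x u"
    unfolding separated_def by blast
  have "Suc (nu (?D - {x})) \<le> nu W"
    by (rule nu_edge[OF assms(1) xu(4)]) (use xu(1-3) in auto)
  then have "essential ?D x" using D(2) by (simp add: essential_def)
  then show ?thesis using num_mis_essential_le[OF D(1) xu(1)] D(2) by simp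
qed

lemma num_mis_clique:
  assumes "C \<noteq> {}" "\<And>x y. x \<in> C \<Longrightarrow> y \<in> C \<Longrightarrow> x \<noteq> y \<Longrightarrow> adjacent x y"
  shows "num_mis C = card C"
proof -
  have "max_indeps C = (\<lambda>x. {x}) ` C"
  proof (intro equalityI subsetI)
    fix S assume S: "S \<in> max_indeps C"
    then have "S \<noteq> {}" using assms(1) by (auto simp: max_indeps_def)
    then obtain x where "x \<in> S" by blast
    then have "S = {x}" using S assms(2) unfolding max_indeps_def by blast
    then show "S \<in> (\<lambda>x. {x}) ` C" using S \<open>x \<in> S\<close> by (auto simp: max_indeps_def)
  qed (use assms(2) in \<open>auto simp: max_indeps_def\<close>)
  then show ?thesis by (simp add: num_mis_def card_image)
qed

lemma num_mis_no_edges: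
  assumes "\<And>x y. x \<in> W \<Longrightarrow> y \<in> W \<Longrightarrow> \<not> adjacent x y"
  shows "num_mis W = 1"
proof -
  have "max_indeps W = {W}" using assms unfolding max_indeps_def by blast
  then show ?thesis by (simp add: num_mis_def)
qed

lemma connected_nu_0:
  assumes "finite C" "connected_on C" "nu C = 0"
  obtains x where "C = {x}"
proof -
  obtain x where x: "x \<in> C" using assms(2) by (auto simp: connected_on_def)
  have "\<not> adjacent x y" if "y \<in> C" for y
    using nu_edge[OF assms(1) _ x that, of "{}"] assms(3) by auto
  then have "separated C {x}" using x by (auto simp: separated_def)
  then have "C = {x}" using assms(2) by (auto simp: connected_on_def)
  then show ?thesis using that by blast
qed

lemma adjacent_if_nu_pair:
  assumes "nu {a, b} \<ge> 1"
  shows "adjacent a b"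
proof -
  obtain M where M: "matching_in {a, b} M" "card M = nu {a, b}" using nu_witness[of "{a, b}"] by blast
  then have "M \<noteq> {}" using assms by auto
  then obtain e where "e \<in> M" by blast
  then have e: "e \<in> E" "e \<subseteq> {a, b}" using M(1) by (auto simp: matching_in_def)
  obtain x y where "e = {x, y}" "x \<noteq> y" "adjacent x y" using edgeE[OF e(1)] .
  then show ?thesis using e(2) adjacent_sym by auto
qed

text \<open>An essential vertex would limit the count to 2, so Gallai's lemma yields three vertices.
  Deleting any one of them keeps matching number 1, so the other two are adjacent.\<close>

lemma triangle_if_num_mis_3:
  assumes "finite C" "connected_on C" "nu C = 1" "num_mis C \<ge> 3"
  shows "card C = 3" "\<And>x y. x \<in> C \<Longrightarrow> y \<in> C \<Longrightarrow> x \<noteq> y \<Longrightarrow> adjacent x y"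
proof -
  have ness: "\<not> essential C v" if "v \<in> C" for v
    using num_mis_essential_le[OF assms(1) that] assms(3,4) by auto
  show C: "card C = 3" using gallai[OF assms(1,2) ness] assms(3) by simp
  fix x y assume xy: "x \<in> C" "y \<in> C" "x \<noteq> y"
  have "card (C - {x, y}) = 1" using C xy assms(1) by simp
  then obtain z where z: "C - {x, y} = {z}" by (auto simp: card_1_singleton_iff)
  then have "z \<in> C" "C - {z} = {x, y}" using xy by auto
  then have "nu {x, y} \<ge> 1" using ness[of z] assms(3) by (simp add: essential_def)
  then show "adjacent x y" by (rule adjacent_if_nu_pair)
qed

text \<open>The indexing of the triangles is that of \<^const>\<open>E_graph\<close>; \<open>S\<close> marks the neighbourhood of the
  central vertex.\<close>

definition tri_system :: "'a set \<Rightarrow> (nat \<Rightarrow> 'a) \<Rightarrow> nat \<Rightarrow> 'a set \<Rightarrow> 'a set \<Rightarrow> bool" where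
  "tri_system S p k L W \<longleftrightarrow>
     inj_on p {1..3 * k} \<and> W = p ` {1..3 * k} \<union> L \<and> p ` {1..3 * k} \<inter> L = {} \<and>
     (\<forall>x\<in>L. \<forall>y\<in>W. \<not> adjacent x y) \<and>
     (\<forall>i\<in>{1..3 * k}. \<forall>j\<in>{1..3 * k}.
        adjacent (p i) (p j) \<longleftrightarrow> i \<noteq> j \<and> (i - 1) div 3 = (j - 1) div 3) \<and>
     L \<subseteq> S \<and> (\<forall>i\<in>{1..3 * k}. p i \<in> S \<longleftrightarrow> i mod 3 = 1)"

section \<open>Disjoint triangles with one marked vertex each, together with marked isolated
  vertices\<close>

lemma tri_system_insert_isolated:
  assumes "tri_system S p k L W" "x \<notin> W" "x \<in> S" "\<And>y. y \<in> W \<Longrightarrow> \<not> adjacent x y"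
  shows "tri_system S p k (insert x L) (insert x W)"
  using assms adjacent_sym unfolding tri_system_def by auto

text \<open>The three new indices have quotient \<open>k\<close>, different from all earlier ones,
  so they form a block of their own. The marked vertex \<open>a\<close> has to come first, where the
  index has residue 1.\<close>

lemma tri_system_insert_triangle:
  assumes R: "tri_system S p k L R" and C: "{a, b, c} \<inter> R = {}" "distinct [a, b, c]"
    and adj: "adjacent a b" "adjacent a c" "adjacent b c"
    and sep: "\<And>x y. x \<in> {a, b, c} \<Longrightarrow> y \<in> R \<Longrightarrow> \<not> adjacent x y"
    and S: "a \<in> S" "b \<notin> S" "c \<notin> S"
  shows "tri_system S (p(3 * k + 1 := a, 3 * k + 2 := b, 3 * k + 3 := c)) (Suc k) L ({a, b, c} \<union> R)"
    (is "tri_system S ?p _ _ _")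
proof -
  let ?I = "{1..3 * k}" and ?J = "{3 * k + 1, 3 * k + 2, 3 * k + 3}"
  have old: "?p i = p i" if "i \<in> ?I" for i using that by auto
  have new: "?p (3 * k + 1) = a" "?p (3 * k + 2) = b" "?p (3 * k + 3) = c" by auto
  have imI: "?p ` ?I = p ` ?I" using old by (intro image_cong) auto
  have imJ: "?p ` ?J = {a, b, c}" by auto
  have RL: "R = p ` ?I \<union> L" "p ` ?I \<inter> L = {}" and iso: "\<And>x y. x \<in> L \<Longrightarrow> y \<in> R \<Longrightarrow> \<not> adjacent x y"
    using R unfolding tri_system_def by blast+
  have Rp: "p i \<in> R" if "i \<in> ?I" for i using RL(1) that by blast
  have divI: "(i - 1) div 3 \<noteq> k" if "i \<in> ?I" for i using that by auto
  have divJ: "(i - 1) div 3 = k" if "i \<in> ?J" for i using that by auto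
  have f1: "inj_on ?p (?I \<union> ?J)"
  proof (rule inj_on_Un[THEN iffD2], intro conjI)
    show "inj_on ?p ?I" using R old unfolding tri_system_def by (metis inj_on_cong)
    show "inj_on ?p ?J" using C(2) by auto
    have "?p ` ?I \<inter> ?p ` ?J = {}" unfolding imI imJ using Rp C(1) by blast
    then show "?p ` (?I - ?J) \<inter> ?p ` (?J - ?I) = {}" by blast
  qed
  have f2: "{a, b, c} \<union> R = ?p ` (?I \<union> ?J) \<union> L"
    unfolding image_Un imI imJ RL(1) by blast
  have f3: "?p ` (?I \<union> ?J) \<inter> L = {}"
    unfolding image_Un imI imJ using RL C(1) by blast
  have f4: "\<not> adjacent x y" if "x \<in> L" "y \<in> {a, b, c} \<union> R" for x y
  proof (cases "y \<in> R")
    case False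
    then have "\<not> adjacent y x" using sep that RL(1) by blast
    then show ?thesis using adjacent_sym by blast
  qed (use iso that in blast)
  have f5: "adjacent (?p i) (?p j) \<longleftrightarrow> i \<noteq> j \<and> (i - 1) div 3 = (j - 1) div 3"
    if ij: "i \<in> ?I \<union> ?J" "j \<in> ?I \<union> ?J" for i j
  proof (cases "i \<in> ?I"; cases "j \<in> ?I")
    assume "i \<in> ?I" "j \<in> ?I"
    then show ?thesis using R old unfolding tri_system_def by metis
  next
    assume i: "i \<in> ?I" and "j \<notin> ?I"
    then have j: "j \<in> ?J" using ij by blast
    then have "?p j \<in> {a, b, c}" using imJ by blast
    then have "\<not> adjacent (?p i) (?p j)" using sep Rp[OF i] old[OF i] adjacent_sym by metis
    then show ?thesis using divI[OF i] divJ[OF j] by simp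
  next
    assume "i \<notin> ?I" and j: "j \<in> ?I"
    then have i: "i \<in> ?J" using ij by blast
    then have "?p i \<in> {a, b, c}" using imJ by blast
    then have "\<not> adjacent (?p i) (?p j)" using sep Rp[OF j] old[OF j] by metis
    then show ?thesis using divI[OF j] divJ[OF i] by simp
  next
    assume "i \<notin> ?I" "j \<notin> ?I"
    then have J: "i \<in> ?J" "j \<in> ?J" using ij by auto
    have "adjacent (?p i) (?p j) \<longleftrightarrow> i \<noteq> j"
      using J adj adj[THEN adjacent_sym] by auto
    then show ?thesis using divJ[OF J(1)] divJ[OF J(2)] by simp
  qed
  have f6: "L \<subseteq> S" using R unfolding tri_system_def by blast
  have f7: "?p i \<in> S \<longleftrightarrow> i mod 3 = 1" if "i \<in> ?I \<union> ?J" for i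
  proof (cases "i \<in> ?I")
    case True
    then show ?thesis using R old unfolding tri_system_def by metis
  next
    case False
    then have "i \<in> ?J" using that by blast
    moreover have "(3 * k + 1) mod 3 = 1" "(3 * k + 2) mod 3 = 2" "(3 * k + 3) mod 3 = 0"
      by presburger+
    ultimately show ?thesis using S by auto
  qed
  show ?thesis
    unfolding tri_system_def atLeastAtMost_3_Suc
    by (intro conjI ballI; (rule f1 f2 f3 f6 | rule f4 f5 f7; assumption))
qed

text \<open>The last triangle splits off as a clique: it contributes a factor 3, or 2 once its
  marked vertex is deleted. The isolated vertices contribute a factor 1 and disappear in
  \<open>W - S\<close>.\<close>

lemma tri_system_num_mis:
  assumes "tri_system S p k L W"
  shows "num_mis W = 3 ^ k \<and> num_mis (W - S) = 2 ^ k"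
  using assms
proof (induction k arbitrary: W)
  case 0
  then have "W - S = {}" "\<And>x y. x \<in> W \<Longrightarrow> y \<in> W \<Longrightarrow> \<not> adjacent x y"
    unfolding tri_system_def by auto
  moreover from this have "num_mis (W - S) = 1" by (simp only: num_mis_empty)
  ultimately show ?case using num_mis_no_edges[of W] by simp
next
  case (Suc k)
  let ?I = "{1..3 * k}" and ?J = "{3 * k + 1, 3 * k + 2, 3 * k + 3}"
  let ?C = "p ` ?J" and ?R = "p ` ?I \<union> L"
  note T = Suc.prems[unfolded tri_system_def atLeastAtMost_3_Suc]
  have inj: "inj_on p (?I \<union> ?J)" using T by blast
  have "?C \<inter> p ` ?I = p ` (?J \<inter> ?I)" by (rule inj_on_image_Int[OF inj, symmetric]) auto
  also have "?J \<inter> ?I = {}" by auto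
  finally have dis: "?C \<inter> p ` ?I = {}" by (simp only: image_empty)
  have WL: "W = p ` ?I \<union> ?C \<union> L" "(p ` ?I \<union> ?C) \<inter> L = {}"
    using T unfolding image_Un by simp_all
  have iso: "\<not> adjacent x y" if "x \<in> L" "y \<in> W" for x y using T that by simp
  have adj: "adjacent (p i) (p j) \<longleftrightarrow> i \<noteq> j \<and> (i - 1) div 3 = (j - 1) div 3"
    if "i \<in> ?I \<union> ?J" "j \<in> ?I \<union> ?J" for i j using T that by blast
  have LS: "L \<subseteq> S" and pS: "\<And>i. i \<in> ?I \<union> ?J \<Longrightarrow> p i \<in> S \<longleftrightarrow> i mod 3 = 1" using T by blast+
  have WC: "W - ?C = ?R" "?C \<subseteq> W" using WL dis by blast+
  have R: "tri_system S p k L ?R"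
    unfolding tri_system_def
  proof (intro conjI ballI)
    show "inj_on p ?I" using inj by (rule inj_on_subset) auto
    show "p ` ?I \<inter> L = {}" using WL(2) by blast
    show "\<not> adjacent x y" if "x \<in> L" "y \<in> ?R" for x y using iso that WL(1) by blast
    show "adjacent (p i) (p j) \<longleftrightarrow> i \<noteq> j \<and> (i - 1) div 3 = (j - 1) div 3"
      if "i \<in> ?I" "j \<in> ?I" for i j using adj that by simp
    show "p i \<in> S \<longleftrightarrow> i mod 3 = 1" if "i \<in> ?I" for i using pS that by simp
  qed (use LS in simp_all)
  have adjC: "adjacent (p i) (p j) \<longleftrightarrow> i \<noteq> j" if "i \<in> ?J" "j \<in> ?J" for i j
  proof -
    have "(i - 1) div 3 = k" "(j - 1) div 3 = k" using that by auto
    then show ?thesis using adj[OF UnI2[OF that(1)] UnI2[OF that(2)]] by simp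
  qed
  have sep: "separated W ?C"
    unfolding separated_def WC
  proof (intro conjI ballI)
    fix x y assume x: "x \<in> ?C" and y: "y \<in> ?R"
    then obtain i where i: "x = p i" "i \<in> ?J" by blast
    show "\<not> adjacent x y"
    proof (cases "y \<in> L")
      case True
      then have "\<not> adjacent y x" using iso x WC(2) by blast
      then show ?thesis using adjacent_sym by blast
    next
      case False
      then obtain j where j: "y = p j" "j \<in> ?I" using y by blast
      have "(i - 1) div 3 = k" "(j - 1) div 3 \<noteq> k" using i j by auto
      then show ?thesis using adj[OF UnI2[OF i(2)] UnI1[OF j(2)]] i(1) j(1) by simp
    qed
  qed (fact WC(2))
  have injJ: "inj_on p ?J" using inj by (rule inj_on_subset) auto
  have mods: "(3 * k + 1) mod 3 = 1" "(3 * k + 2) mod 3 = 2" "(3 * k + 3) mod 3 = 0"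
    by presburger+
  have S: "p (3 * k + 1) \<in> S" "p (3 * k + 2) \<notin> S" "p (3 * k + 3) \<notin> S"
    using pS[of "3 * k + 1"] pS[of "3 * k + 2"] pS[of "3 * k + 3"] mods by simp_all
  then have CS: "?C - S = p ` {3 * k + 2, 3 * k + 3}" by auto
  have "num_mis ?C = card ?C" using adjC by (intro num_mis_clique) auto
  also have "\<dots> = 3" using injJ by (simp add: card_image)
  finally have 3: "num_mis ?C = 3" .
  have "num_mis (?C - S) = card (?C - S)" unfolding CS using adjC by (intro num_mis_clique) auto
  also have "\<dots> = 2" unfolding CS using injJ by (simp add: inj_on_def)
  finally have 2: "num_mis (?C - S) = 2" .
  have "(W - S) - (?C - S) = ?R - S" using WC by blast
  then have "num_mis (W - S) = num_mis (?C - S) * num_mis (?R - S)"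
    using num_mis_separated[OF separated_Diff_set[OF sep]] by simp
  moreover have "num_mis W = num_mis ?C * num_mis ?R"
    using num_mis_separated[OF sep] WC(1) by simp
  ultimately show ?case using Suc.IH[OF R] 2 3 by simp
qed

text \<open>Components are split off one at a time. An isolated vertex is met by \<open>S\<close>,
  hence lies in it and joins \<open>L\<close>. A component of matching number 1 contributes factors
  at most 3 and 2; attaining both makes it a triangle with exactly one vertex in
  \<open>S\<close>.\<close>

lemma small_components:
  assumes "finite W" "meets_all S W"
    and "\<And>C. separated W C \<Longrightarrow> connected_on C \<Longrightarrow> nu C \<le> 1"
  shows "num_mis (W - S) \<le> 2 ^ nu W"
    and "num_mis W = 3 ^ nu W \<Longrightarrow> num_mis (W - S) = 2 ^ nu W \<Longrightarrow> \<exists>p L. tri_system S p (nu W) L W"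
proof -
  have "num_mis (W - S) \<le> 2 ^ nu W \<and>
    (num_mis W = 3 ^ nu W \<and> num_mis (W - S) = 2 ^ nu W \<longrightarrow> (\<exists>p L. tri_system S p (nu W) L W))"
    using assms
  proof (induction "card W" arbitrary: W rule: less_induct)
    case less
    show ?case
    proof (cases "W = {}")
      case True
      then have "tri_system S p (nu W) {} W" for p by (simp add: tri_system_def nu_empty)
      then show ?thesis using True by (auto simp: nu_empty)
    next
      case False
      obtain C where C: "separated W C" "connected_on C"
        using component_exists[OF less.prems(1) False] by blast
      let ?R = "W - C"
      have sub: "C \<subseteq> W" "C \<noteq> {}" "finite C" "finite ?R"
        using C less.prems(1) finite_subset by (auto simp: separated_def connected_on_def)
      have sepR: "separated W ?R" using separated_Diff[OF C(1)] .
      have mC: "meets_all S C" and mR: "meets_all S ?R"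
        using meets_all_separated less.prems(2) C(1) sepR by blast+
      have "card ?R < card W" using sub less.prems(1) by (intro psubset_card_mono) auto
      then have IH: "num_mis (?R - S) \<le> 2 ^ nu ?R"
        "num_mis ?R = 3 ^ nu ?R \<Longrightarrow> num_mis (?R - S) = 2 ^ nu ?R \<Longrightarrow> \<exists>p L. tri_system S p (nu ?R) L ?R"
        using less.hyps[OF _ sub(4) mR] less.prems(3) separated_trans[OF sepR] by blast+
      have "(W - S) - (C - S) = ?R - S" by blast
      then have prodS: "num_mis (W - S) = num_mis (C - S) * num_mis (?R - S)"
        using num_mis_separated[OF separated_Diff_set[OF C(1)]] by simp
      have prod: "num_mis W = num_mis C * num_mis ?R"
        using num_mis_separated[OF C(1)] .
      have nu: "nu W = nu C + nu ?R" using nu_separated[OF less.prems(1) C(1)] .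
      have "nu C = 0 \<or> nu C = 1" using less.prems(3)[OF C] by auto
      then show ?thesis
      proof
        assume 0: "nu C = 0"
        then obtain x where x: "C = {x}" using connected_nu_0[OF sub(3) C(2)] by blast
        have "x \<in> S" using mC x unfolding meets_all_def separated_def by blast
        have one: "num_mis C = 1" using x by (intro num_mis_no_edges) auto
        have "\<not> adjacent x y" if "y \<in> ?R" for y
          using that C(1) x by (auto simp: separated_def)
        then have "tri_system S p k (insert x L) (insert x ?R)" if "tri_system S p k L ?R" for p k L
          using tri_system_insert_isolated[OF that] x \<open>x \<in> S\<close> by blast
        moreover have "insert x ?R = W" using x sub(1) by blast
        ultimately have ext: "tri_system S p k (insert x L) W" if "tri_system S p k L ?R" for p k L
          using that by metis
        have "C - S = {}" using x \<open>x \<in> S\<close> by blast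
        then have "num_mis (C - S) = 1" by (simp only: num_mis_empty)
        then have eq: "num_mis (W - S) = num_mis (?R - S)" "num_mis W = num_mis ?R" "nu W = nu ?R"
          using prod prodS nu 0 one by simp_all
        show ?thesis unfolding eq using IH ext by blast
      next
        assume 1: "nu C = 1"
        have C2: "num_mis (C - S) \<le> 2"
          using num_mis_Diff_le[OF sub(3) mC] 1 by simp
        have C3: "num_mis C \<le> 3" using num_mis_le_power_nu[OF sub(3)] 1 by simp
        have R3: "num_mis ?R \<le> 3 ^ nu ?R" using num_mis_le_power_nu[OF sub(4)] .
        have "num_mis (W - S) \<le> 2 ^ nu W"
          unfolding prodS nu 1 using mult_le_mono[OF C2 IH(1)] by simp
        moreover have "\<exists>p L. tri_system S p (nu W) L W"
          if eq: "num_mis W = 3 ^ nu W" "num_mis (W - S) = 2 ^ nu W"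
        proof -
          \<comment> \<open>A product attains the product of positive upper bounds only if each
            factor attains its own.\<close>
          have e3: "num_mis C = 3 \<and> num_mis ?R = 3 ^ nu ?R"
            using eq(1) 1 unfolding prod nu by (intro mult_eq_boundsD[OF C3 R3]) auto
          have e2: "num_mis (C - S) = 2 \<and> num_mis (?R - S) = 2 ^ nu ?R"
            using eq(2) 1 unfolding prodS nu by (intro mult_eq_boundsD[OF C2 IH(1)]) auto
          obtain p L where R: "tri_system S p (nu ?R) L ?R" using IH(2) e2 e3 by blast
          have tri: "card C = 3" "\<And>x y. x \<in> C \<Longrightarrow> y \<in> C \<Longrightarrow> x \<noteq> y \<Longrightarrow> adjacent x y"
            using triangle_if_num_mis_3[OF sub(3) C(2) 1] e3 by auto
          \<comment> \<open>The empty vertex set counts one maximal independent set, not two. Once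
            nonempty, \<open>C - S\<close> is a clique, so the count 2 is its size and exactly one
            vertex of the triangle lies in \<open>S\<close>.\<close>
          have "C - S \<noteq> {}"
          proof
            assume "C - S = {}"
            then have "num_mis (C - S) = 1" by (simp only: num_mis_empty)
            then show False using e2 by simp
          qed
          then have "num_mis (C - S) = card (C - S)" using tri(2) by (intro num_mis_clique) auto
          then have "card (C - S) = 2" using e2 by simp
          then obtain b c where bc: "C - S = {b, c}" "b \<noteq> c" by (auto simp: card_2_iff)
          have "S \<inter> C \<noteq> {}" using mC sub(2) unfolding meets_all_def separated_def by blast
          then obtain a where a: "a \<in> S" "a \<in> C" by blast
          have "b \<in> C - S" "c \<in> C - S" using bc(1) by simp_all
          then have abc: "distinct [a, b, c]" "b \<notin> S" "c \<notin> S" "{a, b, c} \<subseteq> C"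
            using a bc(2) by auto
          have "card {a, b, c} = card C" using abc(1) tri(1) by simp
          then have Cabc: "C = {a, b, c}" using card_subset_eq[OF sub(3) abc(4)] by simp
          have "tri_system S (p(3 * nu ?R + 1 := a, 3 * nu ?R + 2 := b, 3 * nu ?R + 3 := c))
              (Suc (nu ?R)) L ({a, b, c} \<union> ?R)"
          proof (rule tri_system_insert_triangle[OF R])
            show "\<not> adjacent x y" if "x \<in> {a, b, c}" "y \<in> ?R" for x y
              using that C(1) Cabc by (auto simp: separated_def)
          qed (use a abc Cabc tri(2) in auto)
          moreover have "{a, b, c} \<union> ?R = W" using Cabc sub(1) by blast
          ultimately show ?thesis using nu 1 by auto
        qed
        ultimately show ?thesis by blast
      qed
    qed
  qed
  then show "num_mis (W - S) \<le> 2 ^ nu W"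
    and "num_mis W = 3 ^ nu W \<Longrightarrow> num_mis (W - S) = 2 ^ nu W \<Longrightarrow> \<exists>p L. tri_system S p (nu W) L W"
    by blast+
qed

text \<open>For a part \<open>C\<close> with \<open>2 \<le> nu C\<close>, the assumed bound falls
  far enough below \<open>3 ^ nu C\<close> to compensate for the weak bound
  \<open>2 * 3 ^ (nu C - 1)\<close> on \<open>C - S\<close>. The calculation writes
  \<open>nu C = c + 2\<close>.\<close>

lemma num_mis_add_Diff_less:
  assumes fin: "finite W" and S: "meets_all S W" and C: "separated W C" "2 \<le> nu C"
    and bound: "num_mis C \<le> 3 ^ (nu C - 1) + 2 ^ (nu C - 1)"
  shows "num_mis W + num_mis (W - S) < 3 ^ nu W + 2 ^ nu W"
proof -
  let ?R = "W - C"
  have finC: "finite C" "finite ?R"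
    using C fin finite_subset by (auto simp: separated_def)
  have sepR: "separated W ?R" using separated_Diff[OF C(1)] .
  have mC: "meets_all S C" and mR: "meets_all S ?R"
    using meets_all_separated S C(1) sepR by blast+
  have "(W - S) - (C - S) = ?R - S" by blast
  then have prodS: "num_mis (W - S) = num_mis (C - S) * num_mis (?R - S)"
    using num_mis_separated[OF separated_Diff_set[OF C(1)]] by simp
  have prod: "num_mis W = num_mis C * num_mis ?R"
    using num_mis_separated[OF C(1)] .
  obtain c where c: "nu C = Suc (Suc c)"
    using C(2) by (metis One_nat_def Suc_1 add_2_eq_Suc le_Suc_ex)
  have c32: "(2::nat) ^ c \<le> 3 ^ c" by (rule power_mono) auto
  have CS: "num_mis (C - S) \<le> 2 * 3 ^ Suc c"
    using num_mis_Diff_le[OF finC(1) mC] c by simp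
  have Cb: "num_mis C \<le> 3 ^ Suc c + 2 ^ Suc c" using bound c by simp
  have Rb: "num_mis ?R \<le> 3 ^ nu ?R" using num_mis_le_power_nu[OF finC(2)] .
  show ?thesis
  proof (cases "nu ?R")
    \<comment> \<open>Here the rest contributes factors at most 1, and the sum is at most
      \<open>3 ^ (c + 2) + 2 ^ (c + 1)\<close>.\<close>
    case 0
    have "nu (?R - S) = 0" using 0 nu_mono[OF finC(2), of "?R - S"] by auto
    then have "num_mis (?R - S) \<le> 1"
      using num_mis_le_power_nu[of "?R - S"] finC(2) by simp
    then have "num_mis (W - S) \<le> 2 * 3 ^ Suc c"
      unfolding prodS using mult_le_mono[OF CS] by fastforce
    moreover have "num_mis W \<le> 3 ^ Suc c + 2 ^ Suc c"
      unfolding prod using mult_le_mono[OF Cb Rb] 0 by simp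
    moreover have "nu W = Suc (Suc c)" using nu_separated[OF fin C(1)] 0 c by simp
    then have "(3::nat) ^ nu W = 3 * 3 ^ Suc c" "(2::nat) ^ nu W = 2 * 2 ^ Suc c" by simp_all
    moreover have "(2::nat) ^ Suc c > 0" by simp
    ultimately show ?thesis by linarith
  next
    \<comment> \<open>With \<open>X = 3 ^ c * 3 ^ r\<close> the two counts are at most
      \<open>9 * X + 6 * (2 ^ c * 3 ^ r)\<close> and \<open>12 * X\<close>, together at most
      \<open>27 * X = 3 ^ nu W\<close>; the positive term \<open>2 ^ nu W\<close> makes the
      inequality strict.\<close>
    case (Suc r)
    have "num_mis (?R - S) \<le> 2 * 3 ^ r" using num_mis_Diff_le[OF finC(2) mR] Suc by simp
    from mult_le_mono[OF CS this] have "num_mis (W - S) \<le> 12 * (3 ^ c * 3 ^ r)"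
      unfolding prodS by simp
    moreover have "num_mis W \<le> (3 ^ Suc c + 2 ^ Suc c) * 3 ^ Suc r"
      unfolding prod using mult_le_mono[OF Cb Rb] Suc by simp
    then have "num_mis W \<le> 9 * (3 ^ c * 3 ^ r) + 6 * (2 ^ c * 3 ^ r)"
      by (simp add: algebra_simps)
    moreover have "(2::nat) ^ c * 3 ^ r \<le> 3 ^ c * 3 ^ r" using c32 by simp
    moreover have "nu W = c + r + 3" using nu_separated[OF fin C(1)] c Suc by simp
    then have "(3::nat) ^ nu W = 27 * (3 ^ c * 3 ^ r)" "(2::nat) ^ nu W > 0"
      by (simp_all add: power_add)
    ultimately show ?thesis by linarith
  qed
qed

text \<open>The assumption on components is what the induction on the matching number will supply.
  One component with \<open>2 \<le> nu C\<close> already makes the sum strictly smaller; without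
  any, the two counts are bounded separately, so equality of the sums forces it in both.\<close>

lemma num_mis_add_Diff_le:
  assumes "finite W" "meets_all S W"
    and bound: "\<And>C. separated W C \<Longrightarrow> connected_on C \<Longrightarrow> 2 \<le> nu C \<Longrightarrow>
      num_mis C \<le> 3 ^ (nu C - 1) + 2 ^ (nu C - 1)"
  shows "num_mis W + num_mis (W - S) \<le> 3 ^ nu W + 2 ^ nu W"
    and "num_mis W + num_mis (W - S) = 3 ^ nu W + 2 ^ nu W \<Longrightarrow> \<exists>p L. tri_system S p (nu W) L W"
proof -
  have "num_mis W + num_mis (W - S) \<le> 3 ^ nu W + 2 ^ nu W \<and>
    (num_mis W + num_mis (W - S) = 3 ^ nu W + 2 ^ nu W \<longrightarrow> (\<exists>p L. tri_system S p (nu W) L W))"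
  proof (cases "\<exists>C. separated W C \<and> connected_on C \<and> 2 \<le> nu C")
    case True
    then show ?thesis using num_mis_add_Diff_less[OF assms(1,2)] bound by fastforce
  next
    case False
    then have "nu C \<le> 1" if "separated W C" "connected_on C" for C using that by force
    note small = small_components[OF assms(1,2) this]
    have "num_mis W \<le> 3 ^ nu W" using num_mis_le_power_nu[OF assms(1)] .
    then show ?thesis using small by fastforce
  qed
  then show "num_mis W + num_mis (W - S) \<le> 3 ^ nu W + 2 ^ nu W"
    and "num_mis W + num_mis (W - S) = 3 ^ nu W + 2 ^ nu W \<Longrightarrow> \<exists>p L. tri_system S p (nu W) L W"
    by blast+
qed

subsection \<open>Graphs on five vertices\<close>

text \<open>Isomorphism of \<open>H\<close> with the subgraph induced by \<open>W\<close>. The map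
  starts at the numbers, so a list or an indexing of the vertices serves as a witness.\<close>

definition represents :: "nat graph \<Rightarrow> 'a set \<Rightarrow> bool" where
  "represents H W \<longleftrightarrow> (\<exists>g. bij_betw g (verts H) W \<and>
     (\<forall>i\<in>verts H. \<forall>j\<in>verts H. adjacent (g i) (g j) \<longleftrightarrow> {i, j} \<in> edges H))"

lemma represents_nth:
  assumes "distinct xs" "set xs = W" "verts H = {..<length xs}"
    and "\<And>i j. i < length xs \<Longrightarrow> j < length xs \<Longrightarrow> adjacent (xs ! i) (xs ! j) \<longleftrightarrow> {i, j} \<in> edges H"
  shows "represents H W"
  unfolding represents_def using assms bij_betw_nth[OF assms(1), of "{..<length xs}" W]
  by (intro exI[of _ "(!) xs"]) auto

lemma represents_complete_graph:
  assumes "finite W" "\<And>x y. x \<in> W \<Longrightarrow> y \<in> W \<Longrightarrow> x \<noteq> y \<Longrightarrow> adjacent x y"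
  shows "represents (complete_graph (card W)) W"
proof -
  obtain xs where xs: "set xs = W" "distinct xs" using finite_distinct_list[OF assms(1)] by blast
  then have len: "length xs = card W" using distinct_card by metis
  show ?thesis
  proof (rule represents_nth[OF xs(2,1)])
    fix i j assume ij: "i < length xs" "j < length xs"
    have "adjacent (xs ! i) (xs ! j) \<longleftrightarrow> i \<noteq> j"
      using ij xs assms(2)[of "xs ! i" "xs ! j"] by (auto simp: nth_eq_iff_index_eq)
    also have "\<dots> \<longleftrightarrow> {i, j} \<in> edges (complete_graph (card W))"
      using ij len by (auto simp: complete_graph_def nsets_def card_insert_if)
    finally show "adjacent (xs ! i) (xs ! j) \<longleftrightarrow> {i, j} \<in> edges (complete_graph (card W))" .
  qed (simp add: complete_graph_def len)
qed

lemma num_mis_complete_graph: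
  assumes "represents (complete_graph n) W" "n > 0"
  shows "num_mis W = n"
proof -
  obtain g where g: "bij_betw g {..<n} W" and adj: "\<And>i j. i < n \<Longrightarrow> j < n \<Longrightarrow>
      adjacent (g i) (g j) \<longleftrightarrow> {i, j} \<in> [{..<n}]\<^bsup>2\<^esup>"
    using assms(1) by (auto simp: represents_def complete_graph_def)
  have "adjacent x y" if xy: "x \<in> W" "y \<in> W" "x \<noteq> y" for x y
  proof -
    obtain i j where "i < n" "j < n" "x = g i" "y = g j"
      using xy g by (auto simp: bij_betw_def)
    then show ?thesis using adj[of i j] xy(3) by (auto simp: nsets_def card_insert_if)
  qed
  moreover have "card W = n" using bij_betw_same_card[OF g] by simp
  ultimately show ?thesis using num_mis_clique[of W] assms(2) by (metis card.empty less_numeral_extra(3))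
qed

text \<open>Besides \<open>x\<close>, the set can contain at most one end of the edge
  \<open>{y, z}\<close>. This covers each vertex of a spanning 5-cycle and each outer vertex of a
  spanning \<open>A5\<close>: two neighbours \<open>u\<close>, \<open>v\<close>, and an edge on the
  other two vertices.\<close>

lemma max_indep_5_cases:
  assumes S: "S \<in> max_indeps {x, u, v, y, z}" "x \<in> S"
    and adj: "adjacent x u" "adjacent x v" "adjacent y z" and ne: "x \<noteq> y" "x \<noteq> z"
  shows "S = {x} \<and> adjacent x y \<and> adjacent x z \<or> S = {x, y} \<and> \<not> adjacent x y \<or>
    S = {x, z} \<and> \<not> adjacent x z"
proof -
  have sub: "S \<subseteq> {x, u, v, y, z}" and ind: "\<And>p q. p \<in> S \<Longrightarrow> q \<in> S \<Longrightarrow> \<not> adjacent p q"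
    and dom: "\<And>w. w \<in> {x, u, v, y, z} \<Longrightarrow> w \<notin> S \<Longrightarrow> \<exists>p\<in>S. adjacent w p"
    using S(1) by (auto simp: max_indeps_def)
  have "u \<notin> S" "v \<notin> S" "y \<notin> S \<or> z \<notin> S" using ind adj S(2) by blast+
  then consider "S = {x}" | "S = {x, y}" | "S = {x, z}" using S(2) sub by auto
  then show ?thesis
  proof cases
    case 1
    then have "adjacent y x" "adjacent z x" using dom[of y] dom[of z] ne by auto
    then show ?thesis using 1 adjacent_sym by blast
  qed (use ind[of x y] ind[of x z] in auto)
qed

text \<open>The candidates are one pair for each missing chord and one singleton for each vertex
  with both chords present. The five chords again form a cycle, so if \<open>k\<close> of them are
  present, \<open>0 < k < 5\<close>, at most \<open>k - 1\<close> vertices have both, leaving at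
  most four candidates. The case split over all chords checks this.\<close>

lemma num_mis_cycle5_sub:
  assumes W: "W = {a, b, c, d, e}" "distinct [a, b, c, d, e]"
    and adj: "adjacent a b" "adjacent b c" "adjacent c d" "adjacent d e" "adjacent e a"
  shows "num_mis W \<le> 5" (is ?le)
    and "num_mis W = 5 \<Longrightarrow>
      \<not> adjacent a c \<and> \<not> adjacent b d \<and> \<not> adjacent c e \<and> \<not> adjacent d a \<and> \<not> adjacent e b \<or>
      adjacent a c \<and> adjacent b d \<and> adjacent c e \<and> adjacent d a \<and> adjacent e b"
proof -
  let ?P = "\<lambda>x y. if adjacent x y then [] else [{x, y}]"
  let ?Q = "\<lambda>x y z. if adjacent x y \<and> adjacent z x then [{x}] else []"
  let ?xs = "?P a c @ ?P b d @ ?P c e @ ?P d a @ ?P e b @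
    ?Q a c d @ ?Q b d e @ ?Q c e a @ ?Q d a b @ ?Q e b c"
  have "max_indeps W \<subseteq> set ?xs"
  proof
    fix S assume S: "S \<in> max_indeps W"
    have "S \<noteq> {}" "S \<subseteq> W" using S W(1) by (auto simp: max_indeps_def)
    then consider "a \<in> S" | "b \<in> S" | "c \<in> S" | "d \<in> S" | "e \<in> S" using W(1) by auto
    then show "S \<in> set ?xs"
    proof cases
      case 1
      have "W = {a, b, e, c, d}" "a \<noteq> c" "a \<noteq> d" using W by auto
      then have "S = {a} \<and> adjacent a c \<and> adjacent d a \<or> S = {a, c} \<and> \<not> adjacent a c \<or>
          S = {d, a} \<and> \<not> adjacent d a"
        using max_indep_5_cases[of S a b e c d] S 1 adj adj[THEN adjacent_sym]
        by (simp add: insert_commute adjacent_commute)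
      then show ?thesis by (elim disjE conjE) simp_all
    next
      case 2
      have "W = {b, c, a, d, e}" "b \<noteq> d" "b \<noteq> e" using W by auto
      then have "S = {b} \<and> adjacent b d \<and> adjacent e b \<or> S = {b, d} \<and> \<not> adjacent b d \<or>
          S = {e, b} \<and> \<not> adjacent e b"
        using max_indep_5_cases[of S b c a d e] S 2 adj adj[THEN adjacent_sym]
        by (simp add: insert_commute adjacent_commute)
      then show ?thesis by (elim disjE conjE) simp_all
    next
      case 3
      have "W = {c, d, b, e, a}" "c \<noteq> e" "c \<noteq> a" using W by auto
      then have "S = {c} \<and> adjacent c e \<and> adjacent a c \<or> S = {c, e} \<and> \<not> adjacent c e \<or>
          S = {a, c} \<and> \<not> adjacent a c"
        using max_indep_5_cases[of S c d b e a] S 3 adj adj[THEN adjacent_sym]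
        by (simp add: insert_commute adjacent_commute)
      then show ?thesis by (elim disjE conjE) simp_all
    next
      case 4
      have "W = {d, e, c, a, b}" "d \<noteq> a" "d \<noteq> b" using W by auto
      then have "S = {d} \<and> adjacent d a \<and> adjacent b d \<or> S = {d, a} \<and> \<not> adjacent d a \<or>
          S = {b, d} \<and> \<not> adjacent b d"
        using max_indep_5_cases[of S d e c a b] S 4 adj adj[THEN adjacent_sym]
        by (simp add: insert_commute adjacent_commute)
      then show ?thesis by (elim disjE conjE) simp_all
    next
      case 5
      have "W = {e, a, d, b, c}" "e \<noteq> b" "e \<noteq> c" using W by auto
      then have "S = {e} \<and> adjacent e b \<and> adjacent c e \<or> S = {e, b} \<and> \<not> adjacent e b \<or>
          S = {c, e} \<and> \<not> adjacent c e"
        using max_indep_5_cases[of S e a d b c] S 5 adj adj[THEN adjacent_sym]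
        by (simp add: insert_commute adjacent_commute)
      then show ?thesis by (elim disjE conjE) simp_all
    qed
  qed
  then have le: "num_mis W \<le> length ?xs"
    unfolding num_mis_def by (meson List.finite_set card_length card_mono order_trans)
  show ?le using le
    by (cases "adjacent a c"; cases "adjacent b d"; cases "adjacent c e"; cases "adjacent d a";
        cases "adjacent e b") simp_all
  assume "num_mis W = 5"
  with le have "5 \<le> length ?xs" by simp
  then show "\<not> adjacent a c \<and> \<not> adjacent b d \<and> \<not> adjacent c e \<and> \<not> adjacent d a \<and> \<not> adjacent e b \<or>
      adjacent a c \<and> adjacent b d \<and> adjacent c e \<and> adjacent d a \<and> adjacent e b"
    by (cases "adjacent a c"; cases "adjacent b d"; cases "adjacent c e"; cases "adjacent d a";
        cases "adjacent e b") simp_all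
qed

text \<open>The count is as for the cycle: the four possible further edges form a 4-cycle, so a
  nonempty proper selection of \<open>k\<close> of them yields at most
  \<open>1 + (4 - k) + (k - 1) = 4\<close> candidates, the first being \<open>{a}\<close>.\<close>

lemma num_mis_bowtie_sub:
  assumes W: "W = {a, b, c, d, e}" "distinct [a, b, c, d, e]"
    and adj: "adjacent a b" "adjacent a c" "adjacent a d" "adjacent a e" "adjacent b c" "adjacent d e"
  shows "num_mis W \<le> 5" (is ?le)
    and "num_mis W = 5 \<Longrightarrow>
      \<not> adjacent b d \<and> \<not> adjacent b e \<and> \<not> adjacent c d \<and> \<not> adjacent c e \<or>
      adjacent b d \<and> adjacent b e \<and> adjacent c d \<and> adjacent c e"
proof -
  let ?P = "\<lambda>x y. if adjacent x y then [] else [{x, y}]"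
  let ?xs = "{a} # ?P b d @ ?P b e @ ?P c d @ ?P c e @
    (if adjacent b d \<and> adjacent b e then [{b}] else []) @
    (if adjacent c d \<and> adjacent c e then [{c}] else []) @
    (if adjacent b d \<and> adjacent c d then [{d}] else []) @
    (if adjacent b e \<and> adjacent c e then [{e}] else [])"
  have "max_indeps W \<subseteq> set ?xs"
  proof
    fix S assume S: "S \<in> max_indeps W"
    have "S \<noteq> {}" "S \<subseteq> W" using S W(1) by (auto simp: max_indeps_def)
    then consider "a \<in> S" | "b \<in> S" | "c \<in> S" | "d \<in> S" | "e \<in> S" using W(1) by auto
    then show "S \<in> set ?xs"
    proof cases
      case 1
      then have "b \<notin> S" "c \<notin> S" "d \<notin> S" "e \<notin> S"
        using S adj by (auto simp: max_indeps_def)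
      then have "S = {a}" using \<open>S \<subseteq> W\<close> W(1) 1 by auto
      then show ?thesis by simp
    next
      case 2
      have "W = {b, a, c, d, e}" "b \<noteq> d" "b \<noteq> e" using W by auto
      then have "S = {b} \<and> adjacent b d \<and> adjacent b e \<or> S = {b, d} \<and> \<not> adjacent b d \<or>
          S = {b, e} \<and> \<not> adjacent b e"
        using max_indep_5_cases[of S b a c d e] S 2 adj adj[THEN adjacent_sym]
        by (simp add: insert_commute adjacent_commute)
      then show ?thesis by (elim disjE conjE) simp_all
    next
      case 3
      have "W = {c, a, b, d, e}" "c \<noteq> d" "c \<noteq> e" using W by auto
      then have "S = {c} \<and> adjacent c d \<and> adjacent c e \<or> S = {c, d} \<and> \<not> adjacent c d \<or>
          S = {c, e} \<and> \<not> adjacent c e"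
        using max_indep_5_cases[of S c a b d e] S 3 adj adj[THEN adjacent_sym]
        by (simp add: insert_commute adjacent_commute)
      then show ?thesis by (elim disjE conjE) simp_all
    next
      case 4
      have "W = {d, a, e, b, c}" "d \<noteq> b" "d \<noteq> c" using W by auto
      then have "S = {d} \<and> adjacent b d \<and> adjacent c d \<or> S = {b, d} \<and> \<not> adjacent b d \<or>
          S = {c, d} \<and> \<not> adjacent c d"
        using max_indep_5_cases[of S d a e b c] S 4 adj adj[THEN adjacent_sym]
        by (simp add: insert_commute adjacent_commute)
      then show ?thesis by (elim disjE conjE) simp_all
    next
      case 5
      have "W = {e, a, d, b, c}" "e \<noteq> b" "e \<noteq> c" using W by auto
      then have "S = {e} \<and> adjacent b e \<and> adjacent c e \<or> S = {b, e} \<and> \<not> adjacent b e \<or>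
          S = {c, e} \<and> \<not> adjacent c e"
        using max_indep_5_cases[of S e a d b c] S 5 adj adj[THEN adjacent_sym]
        by (simp add: insert_commute adjacent_commute)
      then show ?thesis by (elim disjE conjE) simp_all
    qed
  qed
  then have le: "num_mis W \<le> length ?xs"
    unfolding num_mis_def by (meson List.finite_set card_length card_mono order_trans)
  show ?le using le
    by (cases "adjacent b d"; cases "adjacent b e"; cases "adjacent c d"; cases "adjacent c e") simp_all
  assume "num_mis W = 5"
  with le have "5 \<le> length ?xs" by simp
  then show "\<not> adjacent b d \<and> \<not> adjacent b e \<and> \<not> adjacent c d \<and> \<not> adjacent c e \<or>
      adjacent b d \<and> adjacent b e \<and> adjacent c d \<and> adjacent c e"
    by (cases "adjacent b d"; cases "adjacent b e"; cases "adjacent c d"; cases "adjacent c e") simp_all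
qed

lemma num_mis_cycle_graph_5:
  assumes "represents (cycle_graph 5) W"
  shows "num_mis W = 5"
proof -
  obtain g where "bij_betw g (verts (cycle_graph 5)) W"
    and A: "\<forall>i\<in>verts (cycle_graph 5). \<forall>j\<in>verts (cycle_graph 5). adjacent (g i) (g j) \<longleftrightarrow> {i, j} \<in> edges (cycle_graph 5)"
    using assms unfolding represents_def by blast
  then have g: "bij_betw g {..<5} W" by (simp add: cycle_graph_5)
  have adj: "adjacent (g i) (g j) \<longleftrightarrow> {i, j} \<in> {{0, 1}, {1, 2}, {2, 3}, {3, 4}, {4, 0::nat}}"
    if "i < 5" "j < 5" for i j
    using A that unfolding cycle_graph_5 by simp
  have 5: "{..<5} = {0, 1, 2, 3, 4::nat}" by auto
  have W: "W = {g 0, g 1, g 2, g 3, g 4}" and inj: "inj_on g {0, 1, 2, 3, 4}"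
    using g unfolding 5 bij_betw_def by auto
  have d: "distinct [g 0, g 1, g 2, g 3, g 4]" and d': "distinct [g 4, g 3, g 2, g 1, g 0]"
    using inj by (simp_all add: inj_on_def)
  have "num_mis W \<le> 5"
    by (rule num_mis_cycle5_sub(1)[OF W d]) (simp_all add: adj doubleton_eq_iff)
  moreover have "{{g 0, g 2}, {g 1, g 3}, {g 2, g 4}, {g 3, g 0}, {g 4, g 1}} \<subseteq> max_indeps W"
    unfolding max_indeps_def W by (auto simp: adj doubleton_eq_iff)
  then have "card {{g 0, g 2}, {g 1, g 3}, {g 2, g 4}, {g 3, g 0}, {g 4, g 1}} \<le> num_mis W"
    unfolding num_mis_def by (rule card_mono[rotated]) (simp add: W)
  moreover have "card {{g 0, g 2}, {g 1, g 3}, {g 2, g 4}, {g 3, g 0}, {g 4, g 1}} = 5"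
    using d d' by (simp add: doubleton_eq_iff)
  ultimately show ?thesis by simp
qed

lemma num_mis_A5:
  assumes "represents A5 W"
  shows "num_mis W = 5"
proof -
  obtain g where "bij_betw g (verts A5) W"
    and A: "\<forall>i\<in>verts A5. \<forall>j\<in>verts A5. adjacent (g i) (g j) \<longleftrightarrow> {i, j} \<in> edges A5"
    using assms unfolding represents_def by blast
  then have g: "bij_betw g {..<5} W" by (simp add: A5_eq)
  have adj: "adjacent (g i) (g j) \<longleftrightarrow> {i, j} \<in> {{1, 2}, {3, 4}, {0, 1}, {0, 2}, {0, 3}, {0, 4::nat}}"
    if "i < 5" "j < 5" for i j
    using A that unfolding A5_eq by simp
  have 5: "{..<5} = {0, 1, 2, 3, 4::nat}" by auto
  have W: "W = {g 0, g 1, g 2, g 3, g 4}" and inj: "inj_on g {0, 1, 2, 3, 4}"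
    using g unfolding 5 bij_betw_def by auto
  have d: "distinct [g 0, g 1, g 2, g 3, g 4]" and d': "distinct [g 4, g 3, g 2, g 1, g 0]"
    using inj by (simp_all add: inj_on_def)
  have "num_mis W \<le> 5"
    by (rule num_mis_bowtie_sub(1)[OF W d]) (simp_all add: adj doubleton_eq_iff)
  moreover have "{{g 0}, {g 1, g 3}, {g 1, g 4}, {g 2, g 3}, {g 2, g 4}} \<subseteq> max_indeps W"
    unfolding max_indeps_def W by (auto simp: adj doubleton_eq_iff)
  then have "card {{g 0}, {g 1, g 3}, {g 1, g 4}, {g 2, g 3}, {g 2, g 4}} \<le> num_mis W"
    unfolding num_mis_def by (rule card_mono[rotated]) (simp add: W)
  moreover have "card {{g 0}, {g 1, g 3}, {g 1, g 4}, {g 2, g 3}, {g 2, g 4}} = 5"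
    using d d' by (simp add: doubleton_eq_iff)
  ultimately show ?thesis by simp
qed

text \<open>Two disjoint edges cover all four vertices, so the partner of \<open>a\<close>
  determines the other edge.\<close>

lemma perfect_matching_4:
  assumes "distinct [a, b, c, d]" "nu {a, b, c, d} \<ge> 2"
  shows "adjacent a b \<and> adjacent c d \<or> adjacent a c \<and> adjacent b d \<or> adjacent a d \<and> adjacent b c"
proof -
  let ?W = "{a, b, c, d}"
  obtain M where M: "matching_in ?W M" "card M = nu ?W" using nu_witness[of ?W] by blast
  have sub: "\<Union>M \<subseteq> ?W" "M \<subseteq> E" using M(1) by (simp_all add: matching_in_def)
  have "card ?W \<le> card (\<Union>M)" using card_Union_matching[OF _ M(1)] M(2) assms by simp
  then have un: "\<Union>M = ?W" using sub(1) by (intro card_seteq) auto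
  then obtain e where e: "e \<in> M" "a \<in> e" by blast
  have "e \<in> E" using e(1) sub(2) by blast
  then obtain y where y: "e = {a, y}" "a \<noteq> y" "adjacent a y" using edge_atE e(2) by metis
  have yW: "y \<in> ?W" using e(1) y(1) sub(1) by blast
  have "M \<noteq> {e}" using M(2) assms(2) by auto
  then obtain f where f: "f \<in> M" "f \<noteq> e" using e(1) by blast
  have "f \<in> E" using f(1) sub(2) by blast
  then obtain z w where zw: "f = {z, w}" "z \<noteq> w" "adjacent z w" using edgeE by metis
  have "f \<inter> e = {}" using M(1) f e(1) by (auto simp: matching_in_def disjoint_def)
  then have "{z, w} \<subseteq> ?W - {a, y}" using zw(1) f(1) y(1) sub(1) by blast
  then show ?thesis using y yW zw adjacent_sym[OF zw(3)] by auto
qed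

text \<open>Deleting any vertex leaves a perfect matching on the other four. Combining these
  matchings produces a spanning 5-cycle or a spanning \<open>A5\<close>, to which the two preceding
  counts apply. The predicate \<open>lab\<close> names the vertices, so that symmetric situations
  are handled by relabelling.\<close>

lemma num_mis_factor_critical_5:
  assumes fin: "finite W" and card: "card W = 5" and nu: "nu W = 2"
    and ness: "\<And>v. v \<in> W \<Longrightarrow> \<not> essential W v"
  shows "num_mis W \<le> 5 \<and> (num_mis W = 5 \<longrightarrow>
    represents A5 W \<or> represents (cycle_graph 5) W \<or> represents (complete_graph 5) W)" 
proof -
  define Q where "Q \<longleftrightarrow> num_mis W \<le> 5 \<and> (num_mis W = 5 \<longrightarrow>
    represents A5 W \<or> represents (cycle_graph 5) W \<or> represents (complete_graph 5) W)"
  define lab where "lab a b c d e \<longleftrightarrow> W = {a, b, c, d, e} \<and> distinct [a, b, c, d, e]" for a b c d e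
  have complete: Q if "num_mis W \<le> 5" "\<And>x y. x \<in> W \<Longrightarrow> y \<in> W \<Longrightarrow> x \<noteq> y \<Longrightarrow> adjacent x y"
    using represents_complete_graph[OF fin] that card unfolding Q_def by metis
  have cyc: Q if l: "lab a b c d e"
    and adj: "adjacent a b" "adjacent b c" "adjacent c d" "adjacent d e" "adjacent e a" for a b c d e
  proof -
    have W: "W = {a, b, c, d, e}" "distinct [a, b, c, d, e]" using l by (auto simp: lab_def)
    note le = num_mis_cycle5_sub(1)[OF W adj]
    show Q
    proof (cases "num_mis W = 5")
      case True
      then consider
        "\<not> adjacent a c" "\<not> adjacent b d" "\<not> adjacent c e" "\<not> adjacent d a" "\<not> adjacent e b" |
        "adjacent a c" "adjacent b d" "adjacent c e" "adjacent d a" "adjacent e b"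
        using num_mis_cycle5_sub(2)[OF W adj] by blast
      then show ?thesis
      proof cases
        case 1
        have "represents (cycle_graph 5) W"
        proof (rule represents_nth[OF W(2)])
          fix i j assume "i < length [a, b, c, d, e]" "j < length [a, b, c, d, e]"
          then have "i < 5" "j < 5" by simp_all
          then show "adjacent ([a, b, c, d, e] ! i) ([a, b, c, d, e] ! j) \<longleftrightarrow> {i, j} \<in> edges (cycle_graph 5)"
            unfolding less_5_iff cycle_graph_5 using adj 1 adj[THEN adjacent_sym] adjacent_commute
            by (elim disjE) (simp_all add: doubleton_eq_iff)
        qed (use W in \<open>simp_all add: cycle_graph_5\<close>)
        then show ?thesis using le unfolding Q_def by blast
      next
        case 2
        have "adjacent x y" if "x \<in> W" "y \<in> W" "x \<noteq> y" for x y
          using that W(1) adj 2 adj[THEN adjacent_sym] 2[THEN adjacent_sym] by auto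
        then show ?thesis using complete le by blast
      qed
    qed (use le in \<open>simp add: Q_def\<close>)
  qed
  have bow: Q if l: "lab a b c d e"
    and adj: "adjacent a b" "adjacent a c" "adjacent a d" "adjacent a e" "adjacent b c" "adjacent d e"
    for a b c d e
  proof -
    have W: "W = {a, b, c, d, e}" "distinct [a, b, c, d, e]" using l by (auto simp: lab_def)
    note le = num_mis_bowtie_sub(1)[OF W adj]
    show Q
    proof (cases "num_mis W = 5")
      case True
      then consider
        "\<not> adjacent b d" "\<not> adjacent b e" "\<not> adjacent c d" "\<not> adjacent c e" |
        "adjacent b d" "adjacent b e" "adjacent c d" "adjacent c e"
        using num_mis_bowtie_sub(2)[OF W adj] by blast
      then show ?thesis
      proof cases
        case 1
        have "represents A5 W"
        proof (rule represents_nth[OF W(2)])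
          fix i j assume "i < length [a, b, c, d, e]" "j < length [a, b, c, d, e]"
          then have "i < 5" "j < 5" by simp_all
          then show "adjacent ([a, b, c, d, e] ! i) ([a, b, c, d, e] ! j) \<longleftrightarrow> {i, j} \<in> edges A5"
            unfolding less_5_iff A5_eq using adj 1 adj[THEN adjacent_sym] adjacent_commute
            by (elim disjE) (simp_all add: doubleton_eq_iff)
        qed (use W in \<open>simp_all add: A5_eq\<close>)
        then show ?thesis using le unfolding Q_def by blast
      next
        case 2
        have "adjacent x y" if "x \<in> W" "y \<in> W" "x \<noteq> y" for x y
          using that W(1) adj 2 adj[THEN adjacent_sym] 2[THEN adjacent_sym] by auto
        then show ?thesis using complete le by blast
      qed
    qed (use le in \<open>simp add: Q_def\<close>)
  qed
  have pm: "adjacent a b \<and> adjacent c d \<or> adjacent a c \<and> adjacent b d \<or> adjacent a d \<and> adjacent b c"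
    if "lab a b c d e" for a b c d e
  proof (rule perfect_matching_4)
    have "e \<in> W" "W - {e} = {a, b, c, d}" using that by (auto simp: lab_def)
    then show "2 \<le> nu {a, b, c, d}" using ness[of e] nu by (simp add: essential_def)
  qed (use that in \<open>simp add: lab_def\<close>)
  \<comment> \<open>A triangle \<open>a\<close>, \<open>b\<close>, \<open>e\<close> and a disjoint
    edge \<open>{c, d}\<close>: deleting \<open>c\<close> shows that \<open>d\<close> has a
    neighbour in the triangle, and likewise for \<open>c\<close>. A common neighbour gives a
    spanning \<open>A5\<close>, different ones a spanning 5-cycle.\<close>
  have tri: Q if l: "lab a b c d e" and adj: "adjacent a b" "adjacent c d" "adjacent a e" "adjacent b e"
    for a b c d e
  proof -
    note adj' = adj adj[THEN adjacent_sym]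
    have L: "lab a b c e d" "lab a b d e c" using l by (auto simp: lab_def)
    have B: "lab a b e c d" "lab b a e c d" "lab e a b c d"
      using l by (auto simp: lab_def)
    have D: "lab a d c b e" "lab a d c e b" "lab b d c a e" "lab b d c e a" "lab e d c a b" "lab e d c b a"
      using l by (auto simp: lab_def)
    have "adjacent a d \<or> adjacent b d \<or> adjacent e d"
      using pm[OF L(2)] adjacent_commute by blast
    moreover have "adjacent c a \<or> adjacent c b \<or> adjacent c e"
      using pm[OF L(1)] adjacent_commute by blast
    moreover note bow[OF B(1)] bow[OF B(2)] bow[OF B(3)]
      cyc[OF D(1)] cyc[OF D(2)] cyc[OF D(3)] cyc[OF D(4)] cyc[OF D(5)] cyc[OF D(6)]
    ultimately show Q using adj' adjacent_sym[of c] adjacent_sym[of d] by blast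
  qed
  \<comment> \<open>If \<open>e\<close> is adjacent to both or neither of \<open>a\<close> and
    \<open>b\<close>, a triangle with a disjoint edge appears. If it is adjacent to exactly one,
    deleting that one leaves a perfect matching which links \<open>e\<close> and the other end to
    \<open>{c, d}\<close>, closing a 5-cycle.\<close>
  have two_edges: Q if l: "lab a b c d e" and adj: "adjacent a b" "adjacent c d" for a b c d e
  proof -
    note com = adjacent_commute
    have L: "lab b c d e a" "lab a c d e b" "lab a b d e c" "lab a b c e d" "lab c d a b e"
      "lab e b a c d" "lab e b a d c" "lab e a b c d" "lab e a b d c"
      using l by (auto simp: lab_def)
    consider "adjacent a e" "adjacent b e" | "adjacent b e" "\<not> adjacent a e" |
      "adjacent a e" "\<not> adjacent b e" | "\<not> adjacent a e" "\<not> adjacent b e" by blast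
    then show Q
    proof cases
      case 1
      then show Q using tri[OF l] adj by blast
    next
      case 2
      then consider "adjacent a c" "adjacent d e" | "adjacent a d" "adjacent c e"
        using pm[OF L(2)] com by blast
      then show Q
        using cyc[OF L(6)] cyc[OF L(7)] 2 adj adj[THEN adjacent_sym] adjacent_sym[of b e]
          adjacent_sym[of d e] adjacent_sym[of a d] by cases blast+
    next
      case 3
      then consider "adjacent b c" "adjacent d e" | "adjacent b d" "adjacent c e"
        using pm[OF L(1)] com by blast
      then show Q
        using cyc[OF L(8)] cyc[OF L(9)] 3 adj adj[THEN adjacent_sym] adjacent_sym[of a e]
          adjacent_sym[of d e] adjacent_sym[of c e] by cases blast+
    next
      case 4
      then have "adjacent d e" "adjacent c e" using pm[OF L(3)] pm[OF L(4)] by blast+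
      then show Q using tri[OF L(5)] adj by blast
    qed
  qed
  obtain xs where xs: "set xs = W" "distinct xs" using finite_distinct_list[OF fin] by blast
  then have "length xs = 5" using card distinct_card by metis
  then obtain a b c d e where "xs = [a, b, c, d, e]"
    by (auto simp: numeral_eq_Suc length_Suc_conv)
  then have l: "lab a b c d e" using xs by (simp add: lab_def)
  then have L: "lab a c b d e" "lab a d b c e" by (auto simp: lab_def)
  have Q using pm[OF l] two_edges[OF l] two_edges[OF L(1)] two_edges[OF L(2)] by blast
  then show ?thesis by (simp add: Q_def)
qed

subsection \<open>Connected graphs\<close>

lemma representsE:
  assumes "represents H W"
  obtains g where "bij_betw g (verts H) W"
    "\<And>i j. i \<in> verts H \<Longrightarrow> j \<in> verts H \<Longrightarrow> adjacent (g i) (g j) \<longleftrightarrow> {i, j} \<in> edges H"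
  using assms unfolding represents_def by blast

text \<open>The indexing \<open>p\<close> of the triangles is extended by the centre
  \<open>v\<close> at 0 and by a bijection from the numbers above \<open>3 * k\<close> onto
  \<open>L\<close>; the number of leaves is \<open>card L\<close>.\<close>

lemma represents_E_graph:
  assumes fin: "finite W" and v: "v \<in> W" and T: "tri_system (nbrs v) p k L (W - {v})" and L: "L \<noteq> {}"
  obtains l where "l \<ge> 1" "represents (E_graph (Suc k) l) W"
proof -
  let ?I = "{1..3 * k}"
  define l where "l = card L"
  let ?J = "{3 * k + 1..3 * k + l}"
  have inj: "inj_on p ?I" and WL: "W - {v} = p ` ?I \<union> L" "p ` ?I \<inter> L = {}"
    and iso: "\<And>x y. x \<in> L \<Longrightarrow> y \<in> W - {v} \<Longrightarrow> \<not> adjacent x y"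
    and adj: "\<And>i j. i \<in> ?I \<Longrightarrow> j \<in> ?I \<Longrightarrow> adjacent (p i) (p j) \<longleftrightarrow> i \<noteq> j \<and> (i - 1) div 3 = (j - 1) div 3"
    and Lv: "L \<subseteq> nbrs v" and pv: "\<And>i. i \<in> ?I \<Longrightarrow> p i \<in> nbrs v \<longleftrightarrow> i mod 3 = 1"
    using T unfolding tri_system_def by blast+
  have finL: "finite L" using fin WL(1) by (metis finite_Diff finite_Un)
  then have "card ?J = card L" by (simp add: l_def)
  then obtain q where q: "bij_betw q ?J L"
    using finL finite_same_card_bij[of ?J L] by auto
  define g where "g i = (if i = 0 then v else if i \<le> 3 * k then p i else q i)" for i
  have g0: "g 0 = v" by (simp add: g_def)
  have gI: "g i = p i" if "i \<in> ?I" for i using that by (simp add: g_def)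
  have gJ: "g i = q i" if "i \<in> ?J" for i using that by (simp add: g_def)
  have "bij_betw g ?I (p ` ?I)"
    using inj gI by (subst bij_betw_cong[of _ _ p]) (auto simp: bij_betw_def)
  moreover have "bij_betw g ?J L"
    using q gJ by (subst bij_betw_cong[of _ _ q]) auto
  ultimately have "bij_betw g (?I \<union> ?J) (W - {v})"
    using WL by (metis bij_betw_combine)
  moreover have "bij_betw g {0} {v}" by (simp add: g_def)
  ultimately have "bij_betw g ({0} \<union> (?I \<union> ?J)) ({v} \<union> (W - {v}))"
    by (intro bij_betw_combine) auto
  moreover have "{0} \<union> (?I \<union> ?J) = {..3 * k + l}" by auto
  moreover have "{v} \<union> (W - {v}) = W" using v by blast
  ultimately have bij: "bij_betw g {..3 * k + l} W" by simp
  have qL: "q i \<in> L" if "i \<in> ?J" for i using q that by (auto simp: bij_betw_def)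
  have LW: "L \<subseteq> W - {v}" "p ` ?I \<subseteq> W - {v}" using WL by auto
  have vp: "adjacent v (p i) \<longleftrightarrow> i mod 3 = 1" "adjacent (p i) v \<longleftrightarrow> i mod 3 = 1" if "i \<in> ?I" for i
    using pv[OF that] adjacent_commute by (auto simp: nbrs_def)
  have vq: "adjacent v (q i)" "adjacent (q i) v" if "i \<in> ?J" for i
    using qL[OF that] Lv adjacent_sym by (auto simp: nbrs_def)
  have qq: "\<not> adjacent (q i) (q j)" if "i \<in> ?J" "j \<in> ?J" for i j
    using iso qL that LW by blast
  have qp: "\<not> adjacent (q i) (p j)" "\<not> adjacent (p j) (q i)" if "i \<in> ?J" "j \<in> ?I" for i j
    using iso[of "q i" "p j"] qL[OF that(1)] that(2) LW adjacent_sym by blast+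
  have split: "i = 0 \<or> i \<in> ?I \<or> i \<in> ?J" if "i \<le> 3 * k + l" for i using that by auto
  have "adjacent (g i) (g j) \<longleftrightarrow> {i, j} \<in> edges (E_graph (Suc k) l)"
    if ij: "i \<le> 3 * k + l" "j \<le> 3 * k + l" for i j
    unfolding E_graph_edge_iff[OF ij] using split[OF ij(1)] split[OF ij(2)]
    by (elim disjE) (auto simp: gI gJ g0 adj vp vq qq qp)
  then have "represents (E_graph (Suc k) l) W"
    unfolding represents_def using bij by auto
  moreover have "l \<ge> 1" using L finL by (simp add: l_def card_gt_0_iff Suc_leI)
  ultimately show ?thesis using that by blast
qed

text \<open>A leaf is isolated in \<open>W - {v}\<close>, so it lies in every maximal independent
  set there. All of these therefore meet \<open>nbrs v\<close>, and the split at \<open>v\<close>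
  loses nothing.\<close>

lemma tri_system_center:
  assumes fin: "finite W" and v: "v \<in> W" and T: "tri_system (nbrs v) p k L (W - {v})" and L: "L \<noteq> {}"
  shows "num_mis W = 3 ^ k + 2 ^ k"
proof -
  obtain x where x: "x \<in> L" using L by blast
  then have x': "x \<in> W - {v}" "x \<in> nbrs v" "\<And>y. y \<in> W - {v} \<Longrightarrow> \<not> adjacent x y"
    using T unfolding tri_system_def by blast+
  have "x \<in> S" if "S \<in> max_indeps (W - {v})" for S
    using that x'(1,3) unfolding max_indeps_def by blast
  then have "{S \<in> max_indeps (W - {v}). S \<inter> nbrs v \<noteq> {}} = max_indeps (W - {v})"
    using x'(2) by blast
  then show ?thesis
    using num_mis_split[OF fin v] tri_system_num_mis[OF T] by (simp add: num_mis_def)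
qed

text \<open>The numbering is read back as a triangle system around \<open>g 0\<close>, with the
  leaves as isolated vertices; they exist because \<open>l \<ge> 1\<close>.\<close>

lemma num_mis_E_graph:
  assumes "represents (E_graph (Suc k) l) W" "l \<ge> 1"
  shows "num_mis W = 3 ^ k + 2 ^ k"
proof -
  let ?I = "{1..3 * k}" and ?J = "{3 * k + 1..3 * k + l}"
  obtain g where "bij_betw g (verts (E_graph (Suc k) l)) W" and
    A: "\<And>i j. i \<in> verts (E_graph (Suc k) l) \<Longrightarrow> j \<in> verts (E_graph (Suc k) l) \<Longrightarrow>
      adjacent (g i) (g j) \<longleftrightarrow> {i, j} \<in> edges (E_graph (Suc k) l)"
    using representsE[OF assms(1)] by blast
  then have g: "bij_betw g {..3 * k + l} W" by simp
  have adj: "adjacent (g i) (g j) \<longleftrightarrow>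
    i \<in> ?I \<and> j \<in> ?I \<and> i \<noteq> j \<and> (i - 1) div 3 = (j - 1) div 3 \<or>
    i = 0 \<and> (j \<in> ?I \<and> j mod 3 = 1 \<or> 3 * k < j) \<or>
    j = 0 \<and> (i \<in> ?I \<and> i mod 3 = 1 \<or> 3 * k < i)"
    if "i \<le> 3 * k + l" "j \<le> 3 * k + l" for i j
    using A that unfolding E_graph_edge_iff[OF that, symmetric] by simp
  have all: "{..3 * k + l} = insert 0 (?I \<union> ?J)" by auto
  have inj: "inj_on g (insert 0 (?I \<union> ?J))" and W: "W = insert (g 0) (g ` (?I \<union> ?J))"
    using g unfolding all bij_betw_def by auto
  have "g 0 \<notin> g ` (?I \<union> ?J)" using inj by simp
  then have W0: "W - {g 0} = g ` ?I \<union> g ` ?J" unfolding W image_Un by blast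
  have "tri_system (nbrs (g 0)) g k (g ` ?J) (W - {g 0})"
    unfolding tri_system_def W0
  proof (intro conjI ballI)
    show "inj_on g ?I" using inj by (rule inj_on_subset) auto
    have "g ` ?I \<inter> g ` ?J = g ` (?I \<inter> ?J)"
      by (rule inj_on_image_Int[OF inj, symmetric]) auto
    also have "?I \<inter> ?J = {}" by auto
    finally show "g ` ?I \<inter> g ` ?J = {}" by (simp only: image_empty)
    show "\<not> adjacent x y" if xy: "x \<in> g ` ?J" "y \<in> g ` ?I \<union> g ` ?J" for x y
    proof -
      obtain i j where "x = g i" "y = g j" "i \<in> ?J" "j \<in> ?I \<union> ?J" using xy by blast
      then show ?thesis using adj[of i j] by auto
    qed
    show "adjacent (g i) (g j) \<longleftrightarrow> i \<noteq> j \<and> (i - 1) div 3 = (j - 1) div 3"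
      if "i \<in> ?I" "j \<in> ?I" for i j using adj[of i j] that by auto
    show "g ` ?J \<subseteq> nbrs (g 0)"
    proof
      fix x assume "x \<in> g ` ?J"
      then obtain i where "x = g i" "i \<in> ?J" by blast
      then show "x \<in> nbrs (g 0)" using adj[of 0 i] by (auto simp: nbrs_def)
    qed
    show "g i \<in> nbrs (g 0) \<longleftrightarrow> i mod 3 = 1" if "i \<in> ?I" for i
      using adj[of 0 i] that by (auto simp: nbrs_def)
  qed simp
  moreover have "finite W" using bij_betw_finite[OF g] by simp
  moreover have "g 0 \<in> W" "g ` ?J \<noteq> {}" using W assms(2) by auto
  ultimately show ?thesis using tri_system_center by blast
qed

text \<open>With no isolated vertices present, the vertices of residue 2, one unmarked vertex from
  each triangle, form such a set.\<close>

lemma tri_system_avoiding: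
  assumes "tri_system S p k {} W"
  obtains I where "I \<in> max_indeps W" "I \<inter> S = {}"
proof -
  let ?I = "{1..3 * k}"
  have W: "W = p ` ?I"
    and adj: "\<And>i j. i \<in> ?I \<Longrightarrow> j \<in> ?I \<Longrightarrow> adjacent (p i) (p j) \<longleftrightarrow> i \<noteq> j \<and> (i - 1) div 3 = (j - 1) div 3"
    and pS: "\<And>i. i \<in> ?I \<Longrightarrow> p i \<in> S \<longleftrightarrow> i mod 3 = 1"
    using assms unfolding tri_system_def by simp_all
  let ?J = "{i \<in> ?I. i mod 3 = 2}"
  have "\<not> adjacent x y" if xy: "x \<in> p ` ?J" "y \<in> p ` ?J" for x y
  proof -
    obtain i j where ij: "x = p i" "y = p j" "i \<in> ?J" "j \<in> ?J" using xy by blast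
    have "n = 3 * ((n - 1) div 3) + 2" if "n \<in> ?J" for n
    proof -
      have "n mod 3 = 2" using that by simp
      then obtain q where "n = 3 * q + 2" using mult_div_mod_eq[of 3 n] by metis
      then show ?thesis by simp
    qed
    from this[OF ij(3)] this[OF ij(4)] have "i = j" if "(i - 1) div 3 = (j - 1) div 3"
      using that by linarith
    then show ?thesis using adj[of i j] ij by blast
  qed
  moreover have "\<exists>x\<in>p ` ?J. adjacent w x" if w: "w \<in> W - p ` ?J" for w
  proof -
    obtain i where i: "w = p i" "i \<in> ?I" using w W by blast
    let ?j = "3 * ((i - 1) div 3) + 2"
    have "(i - 1) div 3 < k" using i(2) by auto
    moreover have "(3 * n + 2) mod 3 = 2" for n :: nat by presburger
    ultimately have j: "?j \<in> ?J" by simp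
    have "i \<notin> ?J" using w i(1) by blast
    then have "i \<noteq> ?j" using j by metis
    moreover have "(?j - 1) div 3 = (i - 1) div 3" by simp
    ultimately have "adjacent w (p ?j)" using adj[of i ?j] i j by simp
    then show ?thesis using j by blast
  qed
  ultimately have "p ` ?J \<in> max_indeps W" using W by (auto simp: max_indeps_def)
  moreover have "p ` ?J \<inter> S = {}" using pS by auto
  ultimately show ?thesis using that by blast
qed

text \<open>A part separated in \<open>W - {v}\<close> and missed by \<open>nbrs v\<close> would be
  separated in \<open>W\<close> too, against connectedness.\<close>

lemma meets_all_nbrs:
  assumes "connected_on W" "v \<in> W"
  shows "meets_all (nbrs v) (W - {v})"
  unfolding meets_all_def
proof (intro allI impI notI)
  fix C assume C: "separated (W - {v}) C \<and> C \<noteq> {}" and "nbrs v \<inter> C = {}"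
  then have "separated W C" by (auto simp: separated_def nbrs_def adjacent_commute)
  then have "C = W" using assms(1) C by (auto simp: connected_on_def)
  then show False using C assms(2) by (auto simp: separated_def)
qed

text \<open>Branching at \<open>v\<close> reduces the count to the sum for \<open>W - {v}\<close>
  and its part outside \<open>nbrs v\<close>. Equality makes \<open>W - {v}\<close> a triangle
  system and also rules out any loss in the branching.\<close>

lemma num_mis_connected_essential:
  assumes fin: "finite W" and con: "connected_on W" and v: "v \<in> W" "essential W v"
    and bound: "\<And>C. C \<subseteq> W - {v} \<Longrightarrow> connected_on C \<Longrightarrow> 2 \<le> nu C \<Longrightarrow> nu C < nu W \<Longrightarrow>
      num_mis C \<le> 3 ^ (nu C - 1) + 2 ^ (nu C - 1)"
  shows "num_mis W \<le> 3 ^ (nu W - 1) + 2 ^ (nu W - 1)"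
    and "num_mis W = 3 ^ (nu W - 1) + 2 ^ (nu W - 1) \<Longrightarrow> \<exists>l\<ge>1. represents (E_graph (nu W) l) W"
proof -
  let ?U = "W - {v}"
  have nu: "nu W = Suc (nu ?U)"
    using nu_remove_vertex[OF fin, of v] v(2) by (simp add: essential_def)
  have finU: "finite ?U" using fin by simp
  have bU: "num_mis C \<le> 3 ^ (nu C - 1) + 2 ^ (nu C - 1)"
    if "separated ?U C" "connected_on C" "2 \<le> nu C" for C
  proof -
    have "C \<subseteq> ?U" using that(1) by (simp add: separated_def)
    then show ?thesis using bound that nu nu_mono[OF finU, of C] by auto
  qed
  note sum = num_mis_add_Diff_le[OF finU meets_all_nbrs[OF con v(1)] bU]
  have le: "num_mis W \<le> num_mis ?U + num_mis (?U - nbrs v)" using num_mis_le_add[OF fin v(1)] .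
  then show "num_mis W \<le> 3 ^ (nu W - 1) + 2 ^ (nu W - 1)" using sum(1) nu by simp
  assume eq: "num_mis W = 3 ^ (nu W - 1) + 2 ^ (nu W - 1)"
  then have eqU: "num_mis ?U + num_mis (?U - nbrs v) = 3 ^ nu ?U + 2 ^ nu ?U"
    using sum(1) le nu by simp
  then obtain p L where T: "tri_system (nbrs v) p (nu ?U) L ?U" using sum(2) by blast
  \<comment> \<open>Without leaves some maximal independent set of \<open>W - {v}\<close> avoids
    \<open>nbrs v\<close>, and the branching inequality is strict.\<close>
  have "L \<noteq> {}"
  proof
    assume "L = {}"
    then obtain I where "I \<in> max_indeps ?U" "I \<inter> nbrs v = {}" using tri_system_avoiding T by blast
    then show False using num_mis_less_add[OF fin v(1)] eqU eq nu by simp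
  qed
  from represents_E_graph[OF fin v(1) T this]
  show "\<exists>l\<ge>1. represents (E_graph (nu W) l) W" unfolding nu by blast
qed

text \<open>The induction hypothesis serves the essential-vertex case, where it bounds the
  components of \<open>W - {v}\<close>; otherwise the vertex count \<open>2 * nu W + 1\<close> is
  decisive.\<close>

lemma num_mis_connected:
  assumes "finite W" "connected_on W" "nu W \<ge> 1"
  shows "num_mis W \<le> h (nu W) \<and> (num_mis W = h (nu W) \<longrightarrow> (\<exists>H\<in>H_family (nu W). represents H W))"
  using assms
proof (induction "nu W" arbitrary: W rule: less_induct)
  case less
  note fin = less.prems(1) and con = less.prems(2)
  show ?case
  proof (cases "\<exists>v\<in>W. essential W v")
    case True
    then obtain v where v: "v \<in> W" "essential W v" by blast
    have bound: "num_mis C \<le> 3 ^ (nu C - 1) + 2 ^ (nu C - 1)"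
      if "C \<subseteq> W - {v}" "connected_on C" "2 \<le> nu C" "nu C < nu W" for C
      using less.hyps[OF that(4) _ that(2)] that(1,3) fin finite_subset[of C W] by (auto simp: h_def)
    note E = num_mis_connected_essential[OF fin con v bound]
    show ?thesis
    proof (cases "nu W = 1")
      \<comment> \<open>The bound for an essential vertex is \<open>3 ^ 0 + 2 ^ 0 = 2\<close> here,
        strictly below \<open>h 1 = 3\<close>, so equality cannot occur.\<close>
      case 1: True
      then show ?thesis using E(1) by (simp add: h_def)
    next
      case False
      then have h: "h (nu W) = 3 ^ (nu W - 1) + 2 ^ (nu W - 1)" by (simp add: h_def)
      have "E_family (nu W) \<subseteq> H_family (nu W)" using False by (auto simp: H_family_def)
      then have "E_graph (nu W) l \<in> H_family (nu W)" if "l \<ge> 1" for l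
        using that unfolding E_family_def by blast
      then show ?thesis using E unfolding h by blast
    qed
  next
    case False
    then have ness: "\<And>v. v \<in> W \<Longrightarrow> \<not> essential W v" by blast
    have card: "card W = 2 * nu W + 1" using gallai[OF fin con ness] .
    consider "nu W = 1" | "nu W = 2" | "3 \<le> nu W" using less.prems(3) by linarith
    then show ?thesis
    proof cases
      case 1
      have "num_mis W \<le> 3" using num_mis_le_power_nu[OF fin] 1 by simp
      moreover have "represents (complete_graph 3) W" if "num_mis W = 3"
        using triangle_if_num_mis_3[OF fin con 1] that represents_complete_graph[OF fin] by fastforce
      ultimately show ?thesis using 1 by (auto simp: h_def H_family_def)
    next
      case 2
      then show ?thesis
        using num_mis_factor_critical_5[OF fin _ 2 ness] card by (auto simp: h_def H_family_def)
    next
      \<comment> \<open>The count is strictly below \<open>h (nu W)\<close>, so the equality claim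
        holds vacuously.\<close>
      case 3
      have "num_mis W ^ 3 \<le> 3 ^ (2 * nu W + 1)" using moon_moser[OF fin] card by simp
      from less_if_cube_le_3_power[OF this 3] 3 show ?thesis by (auto simp: h_def)
    qed
  qed
qed

lemma num_mis_H_family:
  assumes "H \<in> H_family t" "represents H W" "t \<ge> 1"
  shows "num_mis W = h t"
proof -
  have E: "num_mis W = h t" if H: "H \<in> E_family t" and t: "t \<ge> 2"
  proof -
    obtain l where l: "H = E_graph t l" "l \<ge> 1" using H unfolding E_family_def by blast
    obtain k where k: "t = Suc k" using t by (cases t) auto
    show ?thesis using num_mis_E_graph[of k l W] assms(2) l t unfolding k by (simp add: h_def)
  qed
  consider "t = 1" | "t = 2" | "t \<ge> 3" using assms(3) by linarith
  then show ?thesis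
  proof cases
    case 1
    then show ?thesis using assms num_mis_complete_graph[of 3] by (simp add: H_family_def h_def)
  next
    case 2
    then show ?thesis
      using assms E num_mis_complete_graph[of 5] num_mis_A5 num_mis_cycle_graph_5
      by (auto simp: H_family_def h_def)
  next
    case 3
    then show ?thesis using assms(1) E by (simp add: H_family_def)
  qed
qed

end

section \<open>Transfer to graphs given as pairs of vertex and edge sets\<close>

theorem theorem2:
  fixes G :: "'a graph" and t :: nat
  assumes "t \<ge> 1"
    and "simple_graph G"
    and "connected_graph G"
    and "matching_number G = t"
  shows "mis G \<le> h t \<and> (mis G = h t \<longleftrightarrow> (\<exists>H\<in>H_family t. G \<cong>\<^sub>g H))"
proof -
  let ?V = "verts G"
  have fin: "finite ?V" and sub: "edges G \<subseteq> [?V]\<^bsup>2\<^esup>"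
    using assms(2) by (simp_all add: simple_graph_def)
  interpret edge_set "edges G"
    by unfold_locales (use sub in \<open>auto simp: nsets_def\<close>)
  have edge: "u \<in> ?V" "v \<in> ?V" if "{u, v} \<in> edges G" for u v
    using sub that by (auto simp: nsets_def)
  \<comment> \<open>\<open>indep\<close> speaks of distinct pairs only; irreflexivity of adjacency
    closes the gap.\<close>
  have indep: "independent_set G S \<longleftrightarrow> S \<subseteq> ?V \<and> (\<forall>x\<in>S. \<forall>y\<in>S. \<not> adjacent x y)" for S
    unfolding independent_set_def indep_def adjacent_def using adjacent_irrefl[unfolded adjacent_def] by fastforce
  have "maximal_independent_set G S \<longleftrightarrow> S \<in> max_indeps ?V" for S
  proof
    assume S: "maximal_independent_set G S"
    then have i: "independent_set G S" by (simp add: maximal_independent_set_def)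
    have "\<exists>x\<in>S. adjacent w x" if "w \<in> ?V - S" for w
    proof (rule ccontr)
      assume "\<not> (\<exists>x\<in>S. adjacent w x)"
      then have "independent_set G (insert w S)" using i that by (auto simp: indep adjacent_commute)
      then show False using S that unfolding maximal_independent_set_def by blast
    qed
    then show "S \<in> max_indeps ?V" using i by (auto simp: indep max_indeps_def)
  next
    assume S: "S \<in> max_indeps ?V"
    have "\<not> independent_set G T" if "S \<subset> T" for T
    proof
      assume T: "independent_set G T"
      obtain w where "w \<in> T" "w \<notin> S" using \<open>S \<subset> T\<close> by blast
      then show False using T S \<open>S \<subset> T\<close> unfolding indep max_indeps_def by blast
    qed
    then show "maximal_independent_set G S"
      using S by (auto simp: maximal_independent_set_def indep max_indeps_def)
  qed
  then have mis: "mis G = num_mis ?V" by (simp add: mis_def num_mis_def)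
  have "matching G M \<longleftrightarrow> matching_in ?V M" for M
    using sub by (auto simp: matching_def matching_in_def nsets_def)
  then have nu: "nu ?V = t" using assms(4) by (simp add: matching_number_def nu_def)
  have con: "connected_on ?V"
    unfolding connected_on_def
  proof (intro conjI allI impI)
    show "?V \<noteq> {}" using assms(3) by (simp add: connected_graph_def)
    fix C assume C: "separated ?V C \<and> C \<noteq> {}"
    then obtain u where u: "u \<in> C" "u \<in> ?V" by (auto simp: separated_def)
    \<comment> \<open>A separated set is closed under adjacency within the vertex set, so a walk
      starting in \<open>C\<close> never leaves it.\<close>
    have "v \<in> C" if "v \<in> ?V" for v
    proof -
      have "(u, v) \<in> (adj G)\<^sup>*" using assms(3) u(2) that by (simp add: connected_graph_def)
      then show ?thesis
      proof induction
        case base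
        show ?case using u(1) .
      next
        case (step y z)
        then show ?case using C edge[of y z] by (auto simp: adj_def separated_def adjacent_def)
      qed
    qed
    then show "C = ?V" using C by (auto simp: separated_def)
  qed
  have iso: "G \<cong>\<^sub>g H \<longleftrightarrow> represents H ?V" for H :: "nat graph"
  proof
    assume "G \<cong>\<^sub>g H"
    then obtain f where f: "bij_betw f ?V (verts H)"
      "\<And>u v. u \<in> ?V \<Longrightarrow> v \<in> ?V \<Longrightarrow> {u, v} \<in> edges G \<longleftrightarrow> {f u, f v} \<in> edges H"
      unfolding graph_iso_def by blast
    \<comment> \<open>An isomorphism from \<open>G\<close> runs opposite to the map in
      \<open>represents\<close>, so each direction takes the inverse bijection.\<close>
    let ?g = "inv_into ?V f"
    have g: "bij_betw ?g (verts H) ?V" using bij_betw_inv_into[OF f(1)] .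
    have "adjacent (?g i) (?g j) \<longleftrightarrow> {i, j} \<in> edges H" if "i \<in> verts H" "j \<in> verts H" for i j
      using f(2)[of "?g i" "?g j"] that g bij_betw_inv_into_right[OF f(1)]
      by (auto simp: adjacent_def bij_betw_def)
    then show "represents H ?V" unfolding represents_def using g by blast
  next
    assume "represents H ?V"
    then obtain g where g: "bij_betw g (verts H) ?V"
      "\<And>i j. i \<in> verts H \<Longrightarrow> j \<in> verts H \<Longrightarrow> adjacent (g i) (g j) \<longleftrightarrow> {i, j} \<in> edges H"
      using representsE by blast
    let ?f = "inv_into (verts H) g"
    have f: "bij_betw ?f ?V (verts H)" using bij_betw_inv_into[OF g(1)] .
    have "{u, v} \<in> edges G \<longleftrightarrow> {?f u, ?f v} \<in> edges H" if "u \<in> ?V" "v \<in> ?V" for u v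
      using g(2)[of "?f u" "?f v"] that f bij_betw_inv_into_right[OF g(1)]
      by (auto simp: adjacent_def bij_betw_def)
    then show "G \<cong>\<^sub>g H" unfolding graph_iso_def using f by blast
  qed
  show ?thesis
    using num_mis_connected[OF fin con] num_mis_H_family[of _ t ?V] assms(1)
    unfolding mis nu iso by blast
qed

end
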